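(* The collection of all simplified three-dimensional copulas with positive density is nowhere dense in $(\mathcal{C}^3_{{\rm ac},>0},KL)$, i.e. in the set of absolutely continuous three-dimensional copulas with positive density, endowed with the topology of convergence in Kullback–Leibler divergence.
   Context: $\mathbb{I}=[0,1]$, $\lambda^k$ Lebesgue measure. $\mathcal{C}^3_{{\rm ac},>0}$ is the set of absolutely continuous three-dimensional copulas whose density is positive $\lambda^3$-a.e.; for such $C_1,C_2$ with densities $c_1,c_2$ the Kullback–Leibler divergence is $KL(C_1,C_2)=\int_{\mathbb{I}^3}c_1\log(c_1/c_2)\,d\lambda^3$. Points are written $(\mathbf{u},v)$, $\mathbf{u}=(u_1,u_2)$. For a copula $C$, $K_C$ is (a version of) the regular conditional distribution of $(U_1,U_2)$ given $U_3=v$, $(U_1,U_2,U_3)\sim C$; $F_{1|3}(u_1|t)=K_C(t,[0,u_1]\times\mathbb{I})$, $F_{2|3}(u_2|t)=K_C(t,\mathbb{I}\times[0,u_2])$. $C$ is simplified if there is a bivariate copula $A$ with $C(\mathbf{u},v)=\int_{[0,v]}A(F_{1|3}(u_1|t),F_{2|3}(u_2|t))\,d\lambda(t)$ for all $(\mathbf{u},v)$ and, for $\lambda$-a.e. $t$, $F_{1|3}(\cdot|t)$, $F_{2|3}(\cdot|t)$ are continuous. *)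

theory Defs
  imports "HOL-Probability.Probability"
begin

text \<open>Points of the unit cube are written ((u1,u2),v).  Copulas are represented by
their (distribution) functions; by convention they vanish off the unit cube/square,
so that each copula has exactly one representative.\<close>

type_synonym pt3 = "(real \<times> real) \<times> real"

definition I2 :: "(real \<times> real) set" where
  "I2 = {0..1} \<times> {0..1}"

definition I3 :: "pt3 set" where
  "I3 = ({0..1} \<times> {0..1}) \<times> {0..1}"

definition copula2_measure :: "(real \<times> real) measure \<Rightarrow> (real \<times> real \<Rightarrow> real) \<Rightarrow> bool" where
  "copula2_measure \<mu> A \<longleftrightarrow>
     sets \<mu> = sets borel \<and> prob_space \<mu> \<and> emeasure \<mu> I2 = 1 \<and>
     (\<forall>x\<in>{0..1}. emeasure \<mu> ({0..x} \<times> {0..1}) = ennreal x) \<and>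
     (\<forall>x\<in>{0..1}. emeasure \<mu> ({0..1} \<times> {0..x}) = ennreal x) \<and>
     (\<forall>u1\<in>{0..1}. \<forall>u2\<in>{0..1}. A (u1, u2) = measure \<mu> ({0..u1} \<times> {0..u2}))"

definition is_copula2 :: "(real \<times> real \<Rightarrow> real) \<Rightarrow> bool" where
  "is_copula2 A \<longleftrightarrow> (\<exists>\<mu>. copula2_measure \<mu> A) \<and> (\<forall>x. x \<notin> I2 \<longrightarrow> A x = 0)"

definition copula3_measure :: "pt3 measure \<Rightarrow> (pt3 \<Rightarrow> real) \<Rightarrow> bool" where
  "copula3_measure \<mu> C \<longleftrightarrow>
     sets \<mu> = sets borel \<and> prob_space \<mu> \<and> emeasure \<mu> I3 = 1 \<and>
     (\<forall>x\<in>{0..1}. emeasure \<mu> (({0..x} \<times> {0..1}) \<times> {0..1}) = ennreal x) \<and>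
     (\<forall>x\<in>{0..1}. emeasure \<mu> (({0..1} \<times> {0..x}) \<times> {0..1}) = ennreal x) \<and>
     (\<forall>x\<in>{0..1}. emeasure \<mu> (({0..1} \<times> {0..1}) \<times> {0..x}) = ennreal x) \<and>
     (\<forall>u1\<in>{0..1}. \<forall>u2\<in>{0..1}. \<forall>v\<in>{0..1}.
        C ((u1, u2), v) = measure \<mu> (({0..u1} \<times> {0..u2}) \<times> {0..v}))"

definition is_copula3 :: "(pt3 \<Rightarrow> real) \<Rightarrow> bool" where
  "is_copula3 C \<longleftrightarrow> (\<exists>\<mu>. copula3_measure \<mu> C) \<and> (\<forall>x. x \<notin> I3 \<longrightarrow> C x = 0)"

definition is_density3 :: "(pt3 \<Rightarrow> real) \<Rightarrow> (pt3 \<Rightarrow> real) \<Rightarrow> bool" where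
  "is_density3 C c \<longleftrightarrow>
     c \<in> borel_measurable borel \<and> (\<forall>x\<in>I3. 0 \<le> c x) \<and> set_integrable lborel I3 c \<and>
     (\<forall>u1\<in>{0..1}. \<forall>u2\<in>{0..1}. \<forall>v\<in>{0..1}.
        C ((u1, u2), v) = (\<integral>x\<in>({0..u1} \<times> {0..u2}) \<times> {0..v}. c x \<partial>lborel))"

definition Cac_pos :: "(pt3 \<Rightarrow> real) set" where
  "Cac_pos = {C. is_copula3 C \<and>
     (\<exists>c. is_density3 C c \<and> (AE x in lborel. x \<in> I3 \<longrightarrow> 0 < c x))}"

definition density3 :: "(pt3 \<Rightarrow> real) \<Rightarrow> pt3 \<Rightarrow> real" where
  "density3 C = (SOME c. is_density3 C c)"

text \<open>Kullback--Leibler divergence, with value +infinity when the integrand is not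
integrable (its negative part is always integrable, so this is the usual convention).\<close>
definition KL :: "(pt3 \<Rightarrow> real) \<Rightarrow> (pt3 \<Rightarrow> real) \<Rightarrow> ereal" where
  "KL C1 C2 =
     (let c1 = density3 C1; c2 = density3 C2; f = (\<lambda>x. c1 x * ln (c1 x / c2 x))
      in if set_integrable lborel I3 f then ereal (\<integral>x\<in>I3. f x \<partial>lborel) else \<infinity>)"

definition KL_top :: "(pt3 \<Rightarrow> real) topology" where
  "KL_top = topology (\<lambda>U. U \<subseteq> Cac_pos \<and>
     (\<forall>C\<in>U. \<forall>s. (\<forall>n. s n \<in> Cac_pos) \<and> (\<lambda>n. KL (s n) C) \<longlonglongrightarrow> 0
          \<longrightarrow> eventually (\<lambda>n. s n \<in> U) sequentially))"

text \<open>K is a version of the regular conditional distribution of (U1,U2) given U3 = t,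
where (U1,U2,U3) ~ mu (U3 is uniform on [0,1]).\<close>
definition cond_kernel :: "pt3 measure \<Rightarrow> (real \<Rightarrow> (real \<times> real) measure) \<Rightarrow> bool" where
  "cond_kernel \<mu> K \<longleftrightarrow>
     (\<forall>t. prob_space (K t) \<and> sets (K t) = sets borel) \<and>
     (\<forall>E\<in>sets borel. (\<lambda>t. measure (K t) E) \<in> borel_measurable borel) \<and>
     (\<forall>E\<in>sets borel. \<forall>F\<in>sets borel.
        emeasure \<mu> (E \<times> F) = (\<integral>\<^sup>+ t. indicator (F \<inter> {0..1}) t * emeasure (K t) E \<partial>lborel))"

definition F13 :: "(real \<Rightarrow> (real \<times> real) measure) \<Rightarrow> real \<Rightarrow> real \<Rightarrow> real" where
  "F13 K u1 t = measure (K t) ({0..u1} \<times> {0..1})"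

definition F23 :: "(real \<Rightarrow> (real \<times> real) measure) \<Rightarrow> real \<Rightarrow> real \<Rightarrow> real" where
  "F23 K u2 t = measure (K t) ({0..1} \<times> {0..u2})"

definition simplified :: "(pt3 \<Rightarrow> real) \<Rightarrow> bool" where
  "simplified C \<longleftrightarrow> (\<exists>\<mu> K A. copula3_measure \<mu> C \<and> cond_kernel \<mu> K \<and> is_copula2 A \<and>
     (\<forall>u1\<in>{0..1}. \<forall>u2\<in>{0..1}. \<forall>v\<in>{0..1}.
        C ((u1, u2), v) = (\<integral>t\<in>{0..v}. A (F13 K u1 t, F23 K u2 t) \<partial>lborel)) \<and>
     (AE t in lborel. t \<in> {0..1} \<longrightarrow>
        continuous_on {0..1} (\<lambda>u. F13 K u t) \<and> continuous_on {0..1} (\<lambda>u. F23 K u t)))"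

end

theory Submission
  imports Defs
begin

text \<open>
  Write \<open>H t\<close>, \<open>x t\<close>, \<open>y t\<close> for the mass that the conditional law of \<open>(U1, U2)\<close> given \<open>U3 = t\<close> assigns to
  \<open>[0, 1/2] \<times> [0, 1/2]\<close>, \<open>[0, 1/2] \<times> [0, 1]\<close>, \<open>[0, 1] \<times> [0, 1/2]\<close>. For a simplified copula \<open>H = A(x, y)\<close> a.e. with a
  bivariate copula \<open>A\<close>, and copulas are Lipschitz, so
  \<open>\<bar>H s - H t\<bar> \<le> \<bar>x s - x t\<bar> + \<bar>y s - y t\<bar>\<close> for almost all \<open>s\<close> and \<open>t\<close>. This condition is stable
  under convergence of densities in \<open>L1\<close>, hence under convergence in Kullback--Leibler divergence, so it defines
  a closed set containing all simplified copulas.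

  Its interior is empty. Given a density \<open>p\<close>, let \<open>k(u, t)\<close> be the minimum of \<open>p\<close> over the four reflections
  \<open>u\<^sub>i \<mapsto> 1 - u\<^sub>i\<close>, with the sign \<open>sgn(1/2 - u1) sgn(1/2 - u2)\<close>. Adding \<open>\<epsilon> 1\<^sub>B(t) k(u, t)\<close> to \<open>p\<close> changes neither
  \<open>x\<close>, \<open>y\<close> nor the margins, and costs divergence \<open>O(\<epsilon>)\<close> because \<open>\<bar>k\<bar> \<le> p\<close>; but it raises \<open>H\<close> on \<open>B\<close> by
  a positive amount. If \<open>B\<close> is a proper part of a set of positive measure on which \<open>H\<close>, \<open>x\<close>, \<open>y\<close> hardly oscillate,
  the Lipschitz condition fails.
\<close>

subsection \<open>Densities on the cube and their sections\<close>

lemma emeasure_density_lborel: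
  fixes h :: "'a::euclidean_space \<Rightarrow> real"
  assumes "integrable lborel h" "\<And>x. 0 \<le> h x" "X \<in> sets borel"
  shows "emeasure (density lborel (\<lambda>x. ennreal (h x))) X = ennreal (\<integral>x. indicator X x * h x \<partial>lborel)"
proof -
  have "emeasure (density lborel (\<lambda>x. ennreal (h x))) X
    = (\<integral>\<^sup>+x. ennreal (indicator X x * h x) \<partial>lborel)"
    using assms by (subst emeasure_density)
      (auto intro!: nn_integral_cong simp: ennreal_mult' ennreal_indicator mult.commute)
  also have "\<dots> = ennreal (\<integral>x. indicator X x * h x \<partial>lborel)"
    using assms by (intro nn_integral_eq_integral)
      (auto intro!: integrable_real_mult_indicator simp: mult.commute)
  finally show ?thesis .
qed

text \<open>The sets \<open>{..a}\<close> are closed under intersection, generate the Borel sets and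
  exhaust the space with finite mass, so the measures with densities \<open>f\<close> and
  \<open>g\<close> coincide. Densities with respect to a sigma-finite measure are unique almost
  everywhere.\<close>

lemma AE_eq_if_integral_atMost_eq:
  fixes f g :: "'a::ordered_euclidean_space \<Rightarrow> real"
  assumes f: "integrable lborel f" "\<And>x. 0 \<le> f x"
    and g: "integrable lborel g" "\<And>x. 0 \<le> g x"
    and eq: "\<And>a. (\<integral>x. indicator {..a} x * f x \<partial>lborel) = (\<integral>x. indicator {..a} x * g x \<partial>lborel)"
  shows "AE x in lborel. f x = g x"
proof -
  have "density lborel (\<lambda>x. ennreal (f x)) = density lborel (\<lambda>x. ennreal (g x))"
  proof (rule measure_eqI_generator_eq[where E = "range atMost" and \<Omega> = UNIV
        and A = "\<lambda>i. {.. real i *\<^sub>R One}"])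
    show "Int_stable (range (atMost :: 'a \<Rightarrow> 'a set))"
    proof (rule Int_stableI)
      fix X Y assume "X \<in> range (atMost :: 'a \<Rightarrow> 'a set)" "Y \<in> range (atMost :: 'a \<Rightarrow> 'a set)"
      then obtain a b where "X = {..a}" "Y = {..b}" by auto
      then have "X \<inter> Y = {..inf a b}" by auto
      then show "X \<inter> Y \<in> range atMost" by blast
    qed
    show "emeasure (density lborel (\<lambda>x. ennreal (f x))) X = emeasure (density lborel (\<lambda>x. ennreal (g x))) X"
      if "X \<in> range atMost" for X
      using that eq by (auto simp: emeasure_density_lborel[OF f] emeasure_density_lborel[OF g])
    show "(\<Union>i. {.. real i *\<^sub>R (One::'a)}) = UNIV"
    proof (intro equalityI subsetI UNIV_I)
      fix x :: 'a
      obtain n :: nat where "norm x \<le> real n"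
        using real_arch_simple by blast
      then have "x \<bullet> b \<le> real n" if "b \<in> Basis" for b
        using Basis_le_norm[OF that, of x] by linarith
      then show "x \<in> (\<Union>i. {.. real i *\<^sub>R (One::'a)})"
        by (auto simp: eucl_le[where 'a='a])
    qed
  qed (auto simp: borel_eq_atMost emeasure_density_lborel[OF f] emeasure_density_lborel[OF g] sets_eq_imp_space_eq)
  then have "AE x in lborel. ennreal (f x) = ennreal (g x)"
    using f g by (subst (asm) sigma_finite_measure.density_unique_iff[OF sigma_finite_lborel]) auto
  then show ?thesis
    using f g by (auto simp: ennreal_inj)
qed


text \<open>For the density \<open>p\<close> of a copula this is a version of the conditional
  probability of \<open>E\<close> given \<open>U3 = t\<close>, because \<open>U3\<close> is uniform.
  Where the integrand is not integrable, the Bochner integral takes the value 0.\<close>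

definition slice :: "(pt3 \<Rightarrow> real) \<Rightarrow> (real \<times> real) set \<Rightarrow> real \<Rightarrow> real" where
  "slice p E t = (\<integral>u. indicator E u * p (u, t) \<partial>lborel)"

text \<open>Fubini's theorem with the third coordinate as the outer variable.\<close>

lemma
  fixes p :: "pt3 \<Rightarrow> real"
  assumes p: "integrable lborel p"
  shows AE_integrable_section: "AE t in lborel. integrable lborel (\<lambda>u. p (u, t))"
    and integrable_slice: "E \<in> sets borel \<Longrightarrow> integrable lborel (slice p E)"
    and integral_times_eq_slice: "E \<in> sets borel \<Longrightarrow> F \<in> sets borel \<Longrightarrow>
      (\<integral>x. indicator (E \<times> F) x * p x \<partial>lborel) = (\<integral>t. indicator F t * slice p E t \<partial>lborel)"
proof -
  have prod: "integrable (lborel \<Otimes>\<^sub>M lborel) (\<lambda>(u, t). q (u, t))"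
    if "integrable lborel q" for q :: "pt3 \<Rightarrow> real"
    using that by (simp add: lborel_prod)
  have ind: "integrable lborel (\<lambda>x. indicator X x * p x)" if "X \<in> sets borel" for X
    using p that by (auto intro: integrable_real_mult_indicator simp: mult.commute)
  show "AE t in lborel. integrable lborel (\<lambda>u. p (u, t))"
    using lborel_pair.AE_integrable_snd[OF prod[OF p]] .
  show "integrable lborel (slice p E)" if E: "E \<in> sets borel"
  proof -
    have "E \<times> UNIV \<in> sets (borel :: pt3 measure)"
      using E by (simp add: borel_Times)
    from lborel_pair.integrable_snd[OF prod[OF ind[OF this]]]
    show ?thesis by (simp add: slice_def[abs_def] indicator_times)
  qed
  show "(\<integral>x. indicator (E \<times> F) x * p x \<partial>lborel) = (\<integral>t. indicator F t * slice p E t \<partial>lborel)"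
    if E: "E \<in> sets borel" and F: "F \<in> sets borel"
  proof -
    have "E \<times> F \<in> sets (borel :: pt3 measure)"
      using E F by (simp add: borel_Times)
    from lborel_pair.integral_snd[OF prod[OF ind[OF this]]]
    show ?thesis
      by (simp add: slice_def[abs_def] indicator_times lborel_prod mult.assoc mult.left_commute[of "indicator E _"] case_prod_unfold)
  qed
qed

lemma slice_nonneg: "(\<And>x. 0 \<le> p x) \<Longrightarrow> 0 \<le> slice p E t"
  by (simp add: slice_def)

text \<open>The bound does not depend on \<open>E\<close>, and its integral over \<open>t\<close> is
  the L1 distance of \<open>p\<close> and \<open>q\<close>. This is how L1 convergence of densities
  passes to all slices at once.\<close>

lemma AE_abs_slice_diff_le:
  assumes "integrable lborel p" "integrable lborel q" "E \<in> sets borel"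
  shows "AE t in lborel. \<bar>slice p E t - slice q E t\<bar> \<le> slice (\<lambda>x. \<bar>p x - q x\<bar>) UNIV t"
  using AE_integrable_section[OF assms(1)] AE_integrable_section[OF assms(2)]
proof eventually_elim
  case (elim t)
  have int: "integrable lborel (\<lambda>u. indicator E u * r (u, t))"
    if "integrable lborel (\<lambda>u. r (u, t))" for r :: "pt3 \<Rightarrow> real"
    using integrable_real_mult_indicator[OF _ that, of E] assms(3) by (simp add: mult.commute)
  have "\<bar>slice p E t - slice q E t\<bar> = \<bar>\<integral>u. indicator E u * (p (u, t) - q (u, t)) \<partial>lborel\<bar>"
    using int[OF elim(1)] int[OF elim(2)] by (simp add: slice_def right_diff_distrib)
  also have "\<dots> \<le> (\<integral>u. \<bar>indicator E u * (p (u, t) - q (u, t))\<bar> \<partial>lborel)"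
    by (rule integral_abs_bound)
  also have "\<dots> \<le> (\<integral>u. \<bar>p (u, t) - q (u, t)\<bar> \<partial>lborel)"
    using elim int[OF elim(1)] int[OF elim(2)]
    by (intro integral_mono) (auto simp: right_diff_distrib split: split_indicator)
  finally show ?case
    by (simp add: slice_def)
qed

text \<open>Linearity is available at those \<open>t\<close> where both sections are integrable,
  which is almost every \<open>t\<close>.\<close>

lemma AE_slice_add_scaled:
  assumes "integrable lborel p" "integrable lborel q" "E \<in> sets borel"
  shows "AE t in lborel. slice (\<lambda>x. p x + c * q x) E t = slice p E t + c * slice q E t"
  using AE_integrable_section[OF assms(1)] AE_integrable_section[OF assms(2)]
proof eventually_elim
  case (elim t)
  have int: "integrable lborel (\<lambda>u. indicator E u * r (u, t))"
    if "integrable lborel (\<lambda>u. r (u, t))" for r :: "pt3 \<Rightarrow> real"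
    using integrable_real_mult_indicator[OF _ that, of E] assms(3) by (simp add: mult.commute)
  show ?case
    using int[OF elim(1)] int[OF elim(2)]
    by (simp add: slice_def distrib_left mult.left_commute[of "indicator E _"] case_prod_unfold)
qed

section \<open>Densities of a copula: normal form and uniqueness\<close>

text \<open>A normal form of \<open>is_density3\<close>: the density is nonnegative everywhere and
  vanishes off the cube, so that set integrals over \<open>I3\<close> become integrals over the
  whole space.\<close>

definition cube_density :: "(pt3 \<Rightarrow> real) \<Rightarrow> (pt3 \<Rightarrow> real) \<Rightarrow> bool" where
  "cube_density C p \<longleftrightarrow> integrable lborel p \<and> (\<forall>x. 0 \<le> p x) \<and> (\<forall>x. x \<notin> I3 \<longrightarrow> p x = 0) \<and>
     (\<forall>u1\<in>{0..1}. \<forall>u2\<in>{0..1}. \<forall>v\<in>{0..1}. C ((u1, u2), v) =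
        (\<integral>x. indicator (({0..u1} \<times> {0..u2}) \<times> {0..v}) x * p x \<partial>lborel))"

text \<open>Within the cube, \<open>{..a}\<close> is either empty or a box with upper corner
  \<open>min a_i 1\<close>, and there \<open>C\<close> prescribes the integral. Densities with equal
  integrals over all \<open>{..a}\<close> agree almost everywhere.\<close>

lemma cube_density_unique:
  assumes p: "cube_density C p" and q: "cube_density C q"
  shows "AE x in lborel. p x = q x"
proof (rule AE_eq_if_integral_atMost_eq)
  fix a :: pt3
  obtain a1 a2 a3 where a: "a = ((a1, a2), a3)" by (metis prod.collapse)
  show "(\<integral>x. indicator {..a} x * p x \<partial>lborel) = (\<integral>x. indicator {..a} x * q x \<partial>lborel)"
  proof (cases "0 \<le> a1 \<and> 0 \<le> a2 \<and> 0 \<le> a3")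
    case True
    have "(\<integral>x. indicator {..a} x * r x \<partial>lborel) = C ((min a1 1, min a2 1), min a3 1)"
      if "cube_density C r" for r
    proof -
      have "(\<lambda>x. indicator {..a} x * r x) =
        (\<lambda>x. indicator (({0..min a1 1} \<times> {0..min a2 1}) \<times> {0..min a3 1}) x * r x)"
        using that by (fastforce simp: cube_density_def I3_def a indicator_def)
      then show ?thesis using that True by (simp add: cube_density_def)
    qed
    then show ?thesis using p q by simp
  next
    case False
    have "(\<integral>x. indicator {..a} x * r x \<partial>lborel) = 0" if "cube_density C r" for r
    proof -
      have "indicator {..a} x * r x = 0" for x
      proof (cases "x \<in> I3")
        case True
        then have "x \<notin> {..a}" using False by (auto simp: I3_def a)
        then show ?thesis by simp
      qed (use that in \<open>simp add: cube_density_def del: split_paired_All\<close>)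
      then show ?thesis by (intro integral_eq_zero_AE AE_I2)
    qed
    then show ?thesis using p q by simp
  qed
qed (use p q in \<open>auto simp: cube_density_def\<close>)

text \<open>The density picked by \<open>SOME\<close> in \<open>density3\<close> is unconstrained
  off the cube; cutting it off brings it into normal form.\<close>

definition copula_density :: "(pt3 \<Rightarrow> real) \<Rightarrow> pt3 \<Rightarrow> real" where
  "copula_density C x = indicator I3 x * density3 C x"

lemma cube_density_indicator:
  assumes "is_density3 C c"
  shows "cube_density C (\<lambda>x. indicator I3 x * c x)"
proof -
  have "({0..u1} \<times> {0..u2}) \<times> {0..v} \<subseteq> I3"
    if "u1 \<in> {0..1}" "u2 \<in> {0..1}" "v \<in> {0..1}" for u1 u2 v :: real
    using that by (auto simp: I3_def)
  then have "(\<lambda>x. indicator (({0..u1} \<times> {0..u2}) \<times> {0..v}) x * (indicator I3 x * c x))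
     = (\<lambda>x. indicator (({0..u1} \<times> {0..u2}) \<times> {0..v}) x * c x)"
    if "u1 \<in> {0..1}" "u2 \<in> {0..1}" "v \<in> {0..1}" for u1 u2 v :: real
    using that by (intro ext) (auto simp: indicator_def subset_iff)
  then show ?thesis
    using assms by (auto simp: cube_density_def is_density3_def set_integrable_def set_lebesgue_integral_def indicator_def)
qed

text \<open>The density picked by \<open>SOME\<close> need not be the positive one that membership
  in \<open>Cac_pos\<close> provides; positivity carries over by uniqueness. The total mass is
  \<open>C ((1, 1), 1) = 1\<close>.\<close>

lemma Cac_pos_copula_density:
  assumes "C \<in> Cac_pos"
  shows "cube_density C (copula_density C)"
    and "AE x in lborel. x \<in> I3 \<longrightarrow> 0 < copula_density C x"
    and "(\<integral>x. copula_density C x \<partial>lborel) = 1"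
proof -
  obtain c where c: "is_density3 C c" "AE x in lborel. x \<in> I3 \<longrightarrow> 0 < c x"
    using assms by (auto simp: Cac_pos_def)
  then have "is_density3 C (density3 C)"
    unfolding density3_def by (metis someI)
  from cube_density_indicator[OF this] show cd: "cube_density C (copula_density C)"
    by (simp add: copula_density_def[abs_def])
  show "AE x in lborel. x \<in> I3 \<longrightarrow> 0 < copula_density C x"
    using cube_density_unique[OF cd cube_density_indicator[OF c(1)]] c(2)
    by eventually_elim auto
  have "C ((1, 1), 1) = 1"
    using assms by (auto simp: Cac_pos_def is_copula3_def copula3_measure_def I3_def measure_def)
  moreover have "(\<lambda>x. indicator (({0..1} \<times> {0..1}) \<times> {0..1}) x * copula_density C x) = copula_density C"
    by (auto simp: copula_density_def I3_def indicator_def)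
  ultimately show "(\<integral>x. copula_density C x \<partial>lborel) = 1"
    using cd by (simp add: cube_density_def)
qed

lemma cube_density_AE_eq_copula_density:
  assumes "C \<in> Cac_pos" "cube_density C p"
  shows "AE x in lborel. copula_density C x = p x"
  using cube_density_unique Cac_pos_copula_density(1) assms by blast

text \<open>The divergence does not depend on the chosen versions of the densities, so it can be
  computed from explicit ones such as a perturbed density.\<close>

lemma KL_eq:
  assumes C: "C1 \<in> Cac_pos" "C2 \<in> Cac_pos" and p: "cube_density C1 p" and q: "cube_density C2 q"
  shows "KL C1 C2 = (if integrable lborel (\<lambda>x. p x * ln (p x / q x))
     then ereal (\<integral>x. p x * ln (p x / q x) \<partial>lborel) else \<infinity>)"
proof -
  have "(\<lambda>x. indicator I3 x *\<^sub>R (density3 C1 x * ln (density3 C1 x / density3 C2 x)))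
    = (\<lambda>x. copula_density C1 x * ln (copula_density C1 x / copula_density C2 x))"
    by (auto simp: copula_density_def indicator_def)
  then have KL: "KL C1 C2 = (if integrable lborel (\<lambda>x. copula_density C1 x * ln (copula_density C1 x / copula_density C2 x))
     then ereal (\<integral>x. copula_density C1 x * ln (copula_density C1 x / copula_density C2 x) \<partial>lborel) else \<infinity>)"
    by (simp add: KL_def Let_def set_integrable_def set_lebesgue_integral_def)
  have [measurable]: "copula_density C1 \<in> borel_measurable borel" "copula_density C2 \<in> borel_measurable borel"
     "p \<in> borel_measurable borel" "q \<in> borel_measurable borel"
    using C[THEN Cac_pos_copula_density(1)] p q by (auto simp: cube_density_def dest!: borel_measurable_integrable)
  have ae: "AE x in lborel. copula_density C1 x * ln (copula_density C1 x / copula_density C2 x) = p x * ln (p x / q x)"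
    using cube_density_AE_eq_copula_density[OF C(1) p] cube_density_AE_eq_copula_density[OF C(2) q]
    by eventually_elim simp
  have "integrable lborel (\<lambda>x. copula_density C1 x * ln (copula_density C1 x / copula_density C2 x))
     \<longleftrightarrow> integrable lborel (\<lambda>x. p x * ln (p x / q x))"
    by (rule integrable_cong_AE[OF _ _ ae]) auto
  moreover have "(\<integral>x. copula_density C1 x * ln (copula_density C1 x / copula_density C2 x) \<partial>lborel)
     = (\<integral>x. p x * ln (p x / q x) \<partial>lborel)"
    by (rule integral_cong_AE[OF _ _ ae]) auto
  ultimately show ?thesis by (simp add: KL)
qed

subsection \<open>Divergence, convergence in mean and the Lipschitz condition\<close>

text \<open>Via the Hellinger integrand: \<open>(sqrt p - sqrt q)\<^sup>2 \<le> p ln (p/q) - p + q\<close>, then AM--GM with weight \<open>\<eta>\<close>.\<close>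
lemma abs_diff_le_KL_integrand:
  fixes p q \<eta> :: real
  assumes p: "0 \<le> p" and q: "0 \<le> q" and pq: "q = 0 \<Longrightarrow> p = 0" and \<eta>: "0 < \<eta>"
  shows "\<bar>p - q\<bar> \<le> (p * ln (p / q) - p + q) / (2 * \<eta>) + \<eta> * (p + q)"
proof (cases "q = 0")
  case True
  then show ?thesis using pq by simp
next
  case False
  define a b where "a = sqrt p" and "b = sqrt q"
  have ab: "p = a\<^sup>2" "q = b\<^sup>2" "0 \<le> a" "0 < b"
    using p q False by (auto simp: a_def b_def)
  have sq: "(a - b)\<^sup>2 \<le> p * ln (p / q) - p + q"
  proof (cases "a = 0")
    case False
    then have "1 - b / a \<le> ln (a / b)"
      using ab ln_le_minus_one[of "b / a"] by (simp add: ln_div)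
    then have "2 * a\<^sup>2 * (1 - b / a) \<le> 2 * a\<^sup>2 * ln (a / b)"
      by (intro mult_left_mono) auto
    also have "2 * a\<^sup>2 * ln (a / b) = p * ln (p / q)"
      using ab False by (simp add: ln_div ln_realpow algebra_simps)
    also have "2 * a\<^sup>2 * (1 - b / a) = 2 * a\<^sup>2 - 2 * a * b"
      using False by (simp add: power2_eq_square field_simps)
    finally show ?thesis
      by (simp add: ab power2_diff)
  qed (simp add: ab)
  have "2 * \<eta> * (\<bar>a - b\<bar> * (a + b)) \<le> (a - b)\<^sup>2 + (\<eta> * (a + b))\<^sup>2"
    using sum_squares_bound[of "\<bar>a - b\<bar>" "\<eta> * (a + b)"] by (simp add: algebra_simps)
  also have "(\<eta> * (a + b))\<^sup>2 \<le> \<eta>\<^sup>2 * (2 * (p + q))"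
    unfolding power_mult_distrib
    using sum_squares_bound[of a b] by (intro mult_left_mono) (auto simp: ab power2_eq_square algebra_simps)
  also have "\<bar>a - b\<bar> * (a + b) = \<bar>p - q\<bar>"
  proof -
    have "p - q = (a - b) * (a + b)"
      by (simp add: ab power2_eq_square algebra_simps)
    then show ?thesis using ab by (simp add: abs_mult)
  qed
  finally have "2 * \<eta> * \<bar>p - q\<bar> \<le> (p * ln (p / q) - p + q) + \<eta>\<^sup>2 * (2 * (p + q))"
    using sq by linarith
  then show ?thesis
    using \<eta> by (simp add: field_simps power2_eq_square)
qed

text \<open>Integrating the pointwise bound: \<open>- p + q\<close> has integral 0 and
  \<open>p + q\<close> has integral 2. Optimising over \<eta> would give \<open>2 * sqrt KL\<close>,
  Pinsker's inequality with a weaker constant.\<close>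

lemma integral_abs_diff_le_KL:
  fixes p q :: "'a \<Rightarrow> real"
  assumes p: "integrable M p" "\<And>x. 0 \<le> p x" "integral\<^sup>L M p = 1"
    and q: "integrable M q" "\<And>x. 0 \<le> q x" "integral\<^sup>L M q = 1"
    and pq: "AE x in M. q x = 0 \<longrightarrow> p x = 0"
    and int: "integrable M (\<lambda>x. p x * ln (p x / q x))" and \<eta>: "0 < \<eta>"
  shows "(\<integral>x. \<bar>p x - q x\<bar> \<partial>M) \<le> (\<integral>x. p x * ln (p x / q x) \<partial>M) / (2 * \<eta>) + 2 * \<eta>"
proof -
  have "(\<integral>x. \<bar>p x - q x\<bar> \<partial>M)
     \<le> (\<integral>x. (p x * ln (p x / q x) - p x + q x) / (2 * \<eta>) + \<eta> * (p x + q x) \<partial>M)"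
    using p q int pq \<eta> by (intro integral_mono_AE) (auto intro!: abs_diff_le_KL_integrand)
  also have "\<dots> = (\<integral>x. p x * ln (p x / q x) \<partial>M) / (2 * \<eta>) + 2 * \<eta>"
    using p q int by simp
  finally show ?thesis .
qed

lemma KL_tendsto_0_imp_L1:
  assumes s: "\<And>n. s n \<in> Cac_pos" and C: "C \<in> Cac_pos" and lim: "(\<lambda>n. KL (s n) C) \<longlonglongrightarrow> 0"
  shows "(\<lambda>n. \<integral>x. \<bar>copula_density (s n) x - copula_density C x\<bar> \<partial>lborel) \<longlonglongrightarrow> 0"
proof (rule tendstoI)
  fix e :: real assume e: "0 < e"
  \<comment> \<open>With divergence below \<open>\<eta> * e\<close> the bound is less than
    \<open>e/2 + 2 * \<eta> = e/2 + e/4\<close>.\<close>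
  define \<eta> where "\<eta> = e / 8"
  have \<eta>: "0 < \<eta>" using e by (simp add: \<eta>_def)
  have "eventually (\<lambda>n. KL (s n) C < ereal (\<eta> * e)) sequentially"
    using lim \<eta> e by (intro order_tendstoD(2)) auto
  then show "\<forall>\<^sub>F n in sequentially. dist (\<integral>x. \<bar>copula_density (s n) x - copula_density C x\<bar> \<partial>lborel) 0 < e"
  proof eventually_elim
    case (elim n)
    let ?p = "copula_density (s n)" and ?q = "copula_density C"
    note P = Cac_pos_copula_density[OF s[of n]] and Q = Cac_pos_copula_density[OF C]
    \<comment> \<open>A finite upper bound on \<open>KL\<close> excludes the default value
      \<infinity>, hence forces integrability.\<close>
    have int: "integrable lborel (\<lambda>x. ?p x * ln (?p x / ?q x))"
      and le: "(\<integral>x. ?p x * ln (?p x / ?q x) \<partial>lborel) < \<eta> * e"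
      using elim by (auto simp: KL_eq[OF s C P(1) Q(1)] split: if_splits)
    have "(\<integral>x. \<bar>?p x - ?q x\<bar> \<partial>lborel) \<le> (\<integral>x. ?p x * ln (?p x / ?q x) \<partial>lborel) / (2 * \<eta>) + 2 * \<eta>"
    proof (rule integral_abs_diff_le_KL)
      show "AE x in lborel. ?q x = 0 \<longrightarrow> ?p x = 0"
        using Q(2) by eventually_elim (auto simp: copula_density_def)
    qed (use P Q int \<eta> in \<open>auto simp: cube_density_def\<close>)
    also have "\<dots> < (\<eta> * e) / (2 * \<eta>) + 2 * \<eta>"
      using le \<eta> by (intro add_strict_right_mono divide_strict_right_mono) auto
    also have "\<dots> \<le> e"
      using \<eta> e by (simp add: \<eta>_def)
    finally show ?case by simp
  qed
qed

section \<open>The Lipschitz condition and its stability under L1 limits\<close>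

abbreviation "quarter \<equiv> {0..1/2} \<times> {0..1/2} :: (real \<times> real) set"
abbreviation "left_half \<equiv> {0..1/2} \<times> {0..1} :: (real \<times> real) set"
abbreviation "lower_half \<equiv> {0..1} \<times> {0..1/2} :: (real \<times> real) set"

text \<open>A necessary condition for the quarter slice to be a copula function of the two half
  slices. The quantifiers are nested rather than over pairs, so that \<open>s\<close> can be picked
  from one set of positive measure and then \<open>t\<close> from another.\<close>

definition slice_lipschitz :: "(pt3 \<Rightarrow> real) \<Rightarrow> bool" where
  "slice_lipschitz p \<longleftrightarrow> (AE s in lborel. AE t in lborel. s \<in> {0..1} \<longrightarrow> t \<in> {0..1} \<longrightarrow>
     \<bar>slice p quarter s - slice p quarter t\<bar> \<le>
       \<bar>slice p left_half s - slice p left_half t\<bar> + \<bar>slice p lower_half s - slice p lower_half t\<bar>)"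

lemma borel_Times_intervals [measurable, simp]:
  "{a..b} \<times> {c..d} \<in> sets (borel :: (real \<times> real) measure)"
  by (simp add: borel_Times)

text \<open>The slices of \<open>p n\<close> differ from those of \<open>q\<close> by at most
  \<open>D n\<close>, which tends to 0 in L1. Along a subsequence the slices converge almost
  everywhere, and the weak inequality survives the limit.\<close>

lemma slice_lipschitz_L1_limit:
  assumes p: "\<And>n. integrable lborel (p n)" and q: "integrable lborel q"
    and lip: "\<And>n. slice_lipschitz (p n)"
    and lim: "(\<lambda>n. \<integral>x. \<bar>p n x - q x\<bar> \<partial>lborel) \<longlonglongrightarrow> 0"
  shows "slice_lipschitz q"
proof -
  define D where "D n = slice (\<lambda>x. \<bar>p n x - q x\<bar>) UNIV" for n
  have int: "integrable lborel (\<lambda>x. \<bar>p n x - q x\<bar>)" for n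
    using p q by auto
  have D: "integrable lborel (D n)" for n
    unfolding D_def by (intro integrable_slice int) auto
  have "(\<integral>t. norm (D n t) \<partial>lborel) = (\<integral>x. \<bar>p n x - q x\<bar> \<partial>lborel)" for n
    using integral_times_eq_slice[OF int, of UNIV UNIV n]
    by (simp add: D_def slice_nonneg)
  then obtain r :: "nat \<Rightarrow> nat" where r: "AE t in lborel. (\<lambda>n. D (r n) t) \<longlonglongrightarrow> 0"
    using tendsto_L1_AE_subseq[of lborel D] D lim by auto
  have conv: "AE t in lborel. (\<lambda>n. slice (p (r n)) E t) \<longlonglongrightarrow> slice q E t" if E: "E \<in> sets borel" for E
  proof -
    have "AE t in lborel. \<forall>n. \<bar>slice (p (r n)) E t - slice q E t\<bar> \<le> D (r n) t"
      unfolding AE_all_countable D_def using AE_abs_slice_diff_le[OF p q E] by auto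
    with r show ?thesis
    proof eventually_elim
      case (elim t)
      have "(\<lambda>n. slice (p (r n)) E t - slice q E t) \<longlonglongrightarrow> 0"
        by (rule Lim_null_comparison[OF always_eventually elim(1)]) (use elim(2) in simp)
      then show ?case by (simp add: LIM_zero_iff)
    qed
  qed
  define good where "good t \<longleftrightarrow> (\<forall>E\<in>{quarter, left_half, lower_half}.
      (\<lambda>n. slice (p (r n)) E t) \<longlonglongrightarrow> slice q E t)" for t
  have good: "AE t in lborel. good t"
    unfolding good_def using conv[of quarter] conv[of left_half] conv[of lower_half] by (simp del: real_norm_def)
  \<comment> \<open>Countably many exceptional null sets are merged, so that one \<open>s\<close>,
    and then one \<open>t\<close>, serves all \<open>n\<close>.\<close>
  have "AE s in lborel. \<forall>n. AE t in lborel. s \<in> {0..1} \<longrightarrow> t \<in> {0..1} \<longrightarrow>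
     \<bar>slice (p (r n)) quarter s - slice (p (r n)) quarter t\<bar> \<le>
       \<bar>slice (p (r n)) left_half s - slice (p (r n)) left_half t\<bar> +
       \<bar>slice (p (r n)) lower_half s - slice (p (r n)) lower_half t\<bar>"
    unfolding AE_all_countable using lip by (simp only: slice_lipschitz_def simp_thms)
  with good show ?thesis
    unfolding slice_lipschitz_def
  proof eventually_elim
    case (elim s)
    from elim(2)[folded AE_all_countable] good show ?case
    proof eventually_elim
      case (elim t)
      show ?case
      proof (intro impI)
        assume I: "s \<in> {0..1}" "t \<in> {0..1}"
        have "good s" by fact
        then show "\<bar>slice q quarter s - slice q quarter t\<bar> \<le>
       \<bar>slice q left_half s - slice q left_half t\<bar> + \<bar>slice q lower_half s - slice q lower_half t\<bar>"
          using elim I unfolding good_def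
          by (intro LIMSEQ_le[OF _ _ exI[of _ 0]]) (auto intro!: tendsto_intros)
      qed
    qed
  qed
qed

text \<open>The constant sequence \<open>p\<close> converges to \<open>q\<close> in L1.\<close>

lemma slice_lipschitz_AE_cong:
  assumes "integrable lborel p" "integrable lborel q" "AE x in lborel. p x = q x" "slice_lipschitz p"
  shows "slice_lipschitz q"
proof (rule slice_lipschitz_L1_limit[where p = "\<lambda>_. p"])
  have "(\<integral>x. \<bar>p x - q x\<bar> \<partial>lborel) = (\<integral>x. 0 \<partial>(lborel :: pt3 measure))"
    using assms by (intro integral_cong_AE) auto
  then show "(\<lambda>n. \<integral>x. \<bar>p x - q x\<bar> \<partial>lborel) \<longlonglongrightarrow> 0"
    by simp
qed (use assms in auto)

subsection \<open>Simplified copulas\<close>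

text \<open>An increment of \<open>A\<close> in one coordinate is the mass of a rectangle inside a
  strip of full height or width; the uniform margins give that strip mass
  \<open>\<bar>a - a'\<bar>\<close> or \<open>\<bar>b - b'\<bar>\<close>.\<close>

lemma copula2_lipschitz:
  assumes A: "is_copula2 A" and I: "a \<in> {0..1}" "b \<in> {0..1}" "a' \<in> {0..1}" "b' \<in> {0..1}"
  shows "\<bar>A (a, b) - A (a', b')\<bar> \<le> \<bar>a - a'\<bar> + \<bar>b - b'\<bar>"
proof -
  obtain \<mu> where \<mu>: "copula2_measure \<mu> A"
    using A by (auto simp: is_copula2_def)
  then interpret prob_space \<mu> by (simp add: copula2_measure_def)
  have [simp]: "sets \<mu> = sets borel" using \<mu> by (simp add: copula2_measure_def)
  have A_eq: "A (x, y) = prob ({0..x} \<times> {0..y})" if "x \<in> {0..1}" "y \<in> {0..1}" for x y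
    using \<mu> that by (simp add: copula2_measure_def)
  have m1: "prob ({0..x} \<times> {0..1}) = x" and m2: "prob ({0..1} \<times> {0..x}) = x" if "x \<in> {0..1}" for x
    using \<mu> that by (auto simp: copula2_measure_def measure_def)
  have step: "prob S \<le> prob T \<and> prob T - prob S \<le> prob T' - prob S'"
    if "S \<subseteq> T" "S' \<subseteq> T'" "T - S \<subseteq> T' - S'" "{S, T, S', T'} \<subseteq> sets borel" for S T S' T'
  proof -
    have "prob T - prob S = prob (T - S)" "prob T' - prob S' = prob (T' - S')"
      using that by (auto simp: finite_measure_Diff)
    then show ?thesis
      using that finite_measure_mono[of "T - S" "T' - S'"] finite_measure_mono[of S T] by auto
  qed
  have sub: "{0..x} \<times> {0..y} \<subseteq> {0..x'} \<times> {0..y'}" if "x \<le> x'" "y \<le> y'" for x x' y y' :: real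
    using that by auto
  have 1: "\<bar>A (x, y) - A (x', y)\<bar> \<le> \<bar>x - x'\<bar>"
    if "x \<in> {0..1}" "y \<in> {0..1}" "x' \<in> {0..1}" "x \<le> x'" for x x' y
  proof -
    have "{0..x'} \<times> {0..y} - {0..x} \<times> {0..y} \<subseteq> {0..x'} \<times> {0..1} - {0..x} \<times> {0..1}"
      using that by auto
    from step[OF sub sub this] that show ?thesis by (auto simp: A_eq m1)
  qed
  have 2: "\<bar>A (y, x) - A (y, x')\<bar> \<le> \<bar>x - x'\<bar>"
    if "x \<in> {0..1}" "y \<in> {0..1}" "x' \<in> {0..1}" "x \<le> x'" for x x' y
  proof -
    have "{0..y} \<times> {0..x'} - {0..y} \<times> {0..x} \<subseteq> {0..1} \<times> {0..x'} - {0..1} \<times> {0..x}"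
      using that by auto
    from step[OF sub sub this] that show ?thesis by (auto simp: A_eq m2)
  qed
  have "\<bar>A (a, b) - A (a', b)\<bar> \<le> \<bar>a - a'\<bar>"
    using 1[of a b a'] 1[of a' b a] I by linarith
  moreover have "\<bar>A (a', b) - A (a', b')\<bar> \<le> \<bar>b - b'\<bar>"
    using 2[of b a' b'] 2[of b' a' b] I by linarith
  ultimately show ?thesis by linarith
qed

lemma AE_eq_on_unit_if_integral_eq:
  fixes f g :: "real \<Rightarrow> real"
  assumes f: "integrable lborel (\<lambda>t. indicator {0..1} t * f t)" "\<And>t. 0 \<le> f t"
    and g: "integrable lborel (\<lambda>t. indicator {0..1} t * g t)" "\<And>t. 0 \<le> g t"
    and eq: "\<And>v. v \<in> {0..1} \<Longrightarrow>
      (\<integral>t. indicator {0..v} t * f t \<partial>lborel) = (\<integral>t. indicator {0..v} t * g t \<partial>lborel)"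
  shows "AE t in lborel. t \<in> {0..1} \<longrightarrow> f t = g t"
proof -
  have "AE t in lborel. indicator {0..1} t * f t = indicator {0..1} t * g t"
  proof (rule AE_eq_if_integral_atMost_eq)
    fix a :: real
    show "(\<integral>x. indicator {..a} x * (indicator {0..1} x * f x) \<partial>lborel)
      = (\<integral>x. indicator {..a} x * (indicator {0..1} x * g x) \<partial>lborel)"
    proof (cases "0 \<le> a")
      case True
      have "(\<lambda>x. indicator {..a} x * (indicator {0..1} x * h x)) = (\<lambda>x. indicator {0..min a 1} x * h x)" for h :: "real \<Rightarrow> real"
        by (auto simp: indicator_def)
      then show ?thesis using eq[of "min a 1"] True by simp
    next
      case False
      then have "(\<lambda>x. indicator {..a} x * (indicator {0..1} x * h x)) = (\<lambda>x. 0)" for h :: "real \<Rightarrow> real"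
        by (auto simp: indicator_def)
      then show ?thesis by simp
    qed
  qed (use f g in auto)
  then show ?thesis by eventually_elim (auto simp: indicator_def)
qed

lemma cube_density_integral_slice:
  assumes "cube_density C p" "u1 \<in> {0..1}" "u2 \<in> {0..1}" "v \<in> {0..1}"
  shows "(\<integral>t. indicator {0..v} t * slice p ({0..u1} \<times> {0..u2}) t \<partial>lborel) = C ((u1, u2), v)"
  using assms integral_times_eq_slice[of p "{0..u1} \<times> {0..u2}" "{0..v}"]
  by (simp add: cube_density_def)

lemma integrable_indicator_slice:
  assumes "cube_density C p"
  shows "integrable lborel (\<lambda>t. indicator {0..1} t * slice p ({a..b} \<times> {c..d}) t)"
  using assms integrable_real_mult_indicator[OF _ integrable_slice, of "{0..1}" p "{a..b} \<times> {c..d}"]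
  by (simp add: cube_density_def mult.commute)

lemma integrable_unit_bounded:
  fixes f :: "real \<Rightarrow> real"
  assumes "f \<in> borel_measurable borel" "\<And>t. \<bar>f t\<bar> \<le> 1" "0 \<le> v"
  shows "integrable lborel (\<lambda>t. indicator {0..v} t * f t)"
proof (rule Bochner_Integration.integrable_bound)
  show "integrable lborel (indicator {0..v} :: real \<Rightarrow> real)"
    using assms(3) by (simp add: emeasure_lborel_Icc_eq)
qed (use assms in \<open>auto simp: indicator_def\<close>)

text \<open>Integrated over any \<open>{0..v}\<close>, a slice of \<open>p\<close> and the kernel
  mass of the same rectangle both give \<open>C ((u1, u2), v)\<close>, so they agree for almost
  every \<open>t\<close>. In the same way the quarter slice equals \<open>A (?x t, ?y t)\<close>,
  and the Lipschitz bound for \<open>A\<close> applies.\<close>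

lemma simplified_imp_slice_lipschitz:
  assumes p: "cube_density C p" and simp: "simplified C"
  shows "slice_lipschitz p"
proof -
  obtain \<mu> K A where \<mu>: "copula3_measure \<mu> C" and K: "cond_kernel \<mu> K" and A: "is_copula2 A"
    and CA: "\<And>u1 u2 v. u1 \<in> {0..1} \<Longrightarrow> u2 \<in> {0..1} \<Longrightarrow> v \<in> {0..1} \<Longrightarrow>
      C ((u1, u2), v) = (\<integral>t\<in>{0..v}. A (F13 K u1 t, F23 K u2 t) \<partial>lborel)"
    using simp unfolding simplified_def by blast
  interpret prob_space \<mu> using \<mu> by (simp add: copula3_measure_def)
  have K_prob: "prob_space (K t)" for t using K by (simp add: cond_kernel_def)
  have K_le: "measure (K t) E \<le> 1" for t E
    using prob_space.prob_le_1[OF K_prob] .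
  have K_meas[measurable]: "(\<lambda>t. measure (K t) ({a..b} \<times> {c..d})) \<in> borel_measurable borel" for a b c d
    using K by (simp add: cond_kernel_def)
  have K_em: "emeasure \<mu> (E \<times> F) = (\<integral>\<^sup>+ t. indicator (F \<inter> {0..1}) t * emeasure (K t) E \<partial>lborel)"
    if "E \<in> sets borel" "F \<in> sets borel" for E F
    using K that unfolding cond_kernel_def by blast
  have kernel: "AE t in lborel. t \<in> {0..1} \<longrightarrow>
      slice p ({0..u1} \<times> {0..u2}) t = measure (K t) ({0..u1} \<times> {0..u2})"
    if u: "u1 \<in> {0..1}" "u2 \<in> {0..1}" for u1 u2
  proof (rule AE_eq_on_unit_if_integral_eq)
    let ?E = "{0..u1} \<times> {0..u2}"
    fix v :: real assume v: "v \<in> {0..1}"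
    have v1: "{0..v} \<inter> {0..1} = {0..v}" using v by auto
    have int: "integrable lborel (\<lambda>t. indicator {0..v} t * measure (K t) ?E)"
      using v K_le by (intro integrable_unit_bounded) auto
    have "ennreal (C ((u1, u2), v)) = emeasure \<mu> (?E \<times> {0..v})"
      using \<mu> u v by (simp add: copula3_measure_def emeasure_eq_measure)
    also have "\<dots> = (\<integral>\<^sup>+ t. indicator {0..v} t * emeasure (K t) ?E \<partial>lborel)"
      using K_em[of ?E "{0..v}"] by (simp only: v1 borel_Times_intervals borel_closed closed_atLeastAtMost)
    also have "\<dots> = (\<integral>\<^sup>+ t. ennreal (indicator {0..v} t * measure (K t) ?E) \<partial>lborel)"
      using K_prob
      by (intro nn_integral_cong)
        (simp add: finite_measure.emeasure_eq_measure prob_space.finite_measure ennreal_mult' ennreal_indicator)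
    also have "\<dots> = ennreal (\<integral>t. indicator {0..v} t * measure (K t) ?E \<partial>lborel)"
      using int by (intro nn_integral_eq_integral) auto
    finally have "C ((u1, u2), v) = (\<integral>t. indicator {0..v} t * measure (K t) ?E \<partial>lborel)"
      using \<mu> u v by (subst (asm) ennreal_inj) (auto simp: copula3_measure_def)
    then show "(\<integral>t. indicator {0..v} t * slice p ?E t \<partial>lborel) = (\<integral>t. indicator {0..v} t * measure (K t) ?E \<partial>lborel)"
      using cube_density_integral_slice[OF p u v] by simp
  qed (use p K_le in \<open>auto simp: cube_density_def intro!: slice_nonneg integrable_indicator_slice integrable_unit_bounded\<close>)
  let ?x = "F13 K (1/2)" and ?y = "F23 K (1/2)"
  have x: "AE t in lborel. t \<in> {0..1} \<longrightarrow> slice p left_half t = ?x t"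
    using kernel[of "1/2" 1] by (simp add: F13_def)
  have y: "AE t in lborel. t \<in> {0..1} \<longrightarrow> slice p lower_half t = ?y t"
    using kernel[of 1 "1/2"] by (simp add: F23_def)
  have xy: "?x t \<in> {0..1}" "?y t \<in> {0..1}" for t
    using K_le by (auto simp: F13_def F23_def)
  have "A (a, b) \<in> {0..1}" if "(a, b) \<in> I2" for a b
    using A that by (auto simp: is_copula2_def copula2_measure_def I2_def prob_space.prob_le_1)
  then have A01: "A (?x t, ?y t) \<in> {0..1}" for t
    using xy[of t] by (simp add: I2_def)
  \<comment> \<open>Continuity on the closed square and the value 0 off it make \<open>A\<close>
    Borel measurable, which the integrability of \<open>A (?x t, ?y t)\<close> over \<open>t\<close>
    requires.\<close>
  have "continuous_on I2 A"
  proof (rule continuous_onI)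
    fix z e assume z: "z \<in> I2" and e: "0 < (e::real)"
    obtain a b where ab: "z = (a, b)" by (cases z)
    show "\<exists>d>0. \<forall>x'\<in>I2. dist x' z < d \<longrightarrow> dist (A x') (A z) \<le> e"
    proof (intro exI conjI ballI impI)
      fix w assume w: "w \<in> I2" "dist w z < e / 2"
      obtain a' b' where ab': "w = (a', b')" by (cases w)
      have "\<bar>a' - a\<bar> \<le> dist w z" "\<bar>b' - b\<bar> \<le> dist w z"
        using dist_fst_le[of w z] dist_snd_le[of w z] by (auto simp: ab ab' dist_real_def)
      moreover have "dist (A w) (A z) \<le> \<bar>a' - a\<bar> + \<bar>b' - b\<bar>"
        using copula2_lipschitz[OF A, of a' b' a b] w z by (auto simp: ab ab' I2_def dist_real_def)
      ultimately show "dist (A w) (A z) \<le> e" using w by linarith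
    qed (use e in simp)
  qed
  moreover have "closed I2"
    unfolding I2_def by (intro closed_Times closed_atLeastAtMost)
  ultimately have "(\<lambda>z. indicator I2 z *\<^sub>R A z) \<in> borel_measurable borel"
    by (intro borel_measurable_continuous_on_indicator) auto
  moreover have "(\<lambda>z. indicator I2 z *\<^sub>R A z) = A"
    using A by (intro ext) (auto simp: is_copula2_def indicator_def simp del: split_paired_All)
  ultimately have [measurable]: "A \<in> borel_measurable borel" by simp
  have [measurable]: "?x \<in> borel_measurable borel" "?y \<in> borel_measurable borel"
    using K_meas by (auto simp: F13_def[abs_def] F23_def[abs_def])
  have "AE t in lborel. t \<in> {0..1} \<longrightarrow> slice p quarter t = A (?x t, ?y t)"
  proof (rule AE_eq_on_unit_if_integral_eq)
    fix v :: real assume "v \<in> {0..1}"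
    then show "(\<integral>t. indicator {0..v} t * slice p quarter t \<partial>lborel) = (\<integral>t. indicator {0..v} t * A (?x t, ?y t) \<partial>lborel)"
      using cube_density_integral_slice[OF p, of "1/2" "1/2" v] CA[of "1/2" "1/2" v]
      by (simp add: set_lebesgue_integral_def)
  qed (use p A01 in \<open>auto simp: cube_density_def intro!: slice_nonneg integrable_indicator_slice integrable_unit_bounded\<close>)
  with x y have good: "AE t in lborel. t \<in> {0..1} \<longrightarrow> slice p quarter t = A (?x t, ?y t) \<and>
      slice p left_half t = ?x t \<and> slice p lower_half t = ?y t"
    by auto
  show ?thesis
    unfolding slice_lipschitz_def using good
  proof eventually_elim
    case (elim s)
    from good show ?case
      by eventually_elim (use elim xy copula2_lipschitz[OF A] in auto)
  qed
qed

subsection \<open>Alternating perturbations of a density\<close>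

lemma distr_lborel_one_minus: "distr lborel borel (\<lambda>x::real. 1 - x) = lborel"
  using lborel_real_affine[of "-1" 1] by (simp add: density_1)

lemma distr_lborel_reflect:
  shows "distr lborel borel (\<lambda>(a::real, b::real). (1 - a, b)) = lborel"
    and "distr lborel borel (\<lambda>(a::real, b::real). (a, 1 - b)) = lborel"
proof -
  have id: "distr lborel borel (\<lambda>x::real. x) = lborel"
    by (metis distr_cong distr_id sets_lborel)
  have sf: "sigma_finite_measure (distr lborel borel g)"
    if "distr lborel borel g = lborel" for g :: "real \<Rightarrow> real"
    using that sigma_finite_lborel by simp
  have prod: "distr lborel borel (\<lambda>(a, b). (f a, g b)) = lborel"
    if "f \<in> borel_measurable borel" "g \<in> borel_measurable borel"
      "distr lborel borel f = lborel" "distr lborel borel g = lborel" for f g :: "real \<Rightarrow> real"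
  proof -
    have "distr lborel borel f \<Otimes>\<^sub>M distr lborel borel g =
        distr (lborel \<Otimes>\<^sub>M lborel) (borel \<Otimes>\<^sub>M borel) (\<lambda>(a, b). (f a, g b))"
      using that by (intro pair_measure_distr sf) auto
    then show ?thesis
      by (simp only: that lborel_prod borel_prod)
  qed
  show "distr lborel borel (\<lambda>(a::real, b::real). (1 - a, b)) = lborel"
    by (rule prod) (auto simp: id distr_lborel_one_minus)
  show "distr lborel borel (\<lambda>(a::real, b::real). (a, 1 - b)) = lborel"
    by (rule prod) (auto simp: id distr_lborel_one_minus)
qed

lemma borel_measurable_reflect [measurable]:
  "(\<lambda>(a::real, b::real). (1 - a, b)) \<in> borel_measurable borel"
  "(\<lambda>(a::real, b::real). (a, 1 - b)) \<in> borel_measurable borel"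
  by (simp_all add: borel_prod[symmetric])

text \<open>The minimum over the four reflected points is invariant under both reflections, so the
  sign factor makes the function odd under each. As the point itself is among the four, the modulus
  stays below \<open>p\<close>.\<close>

definition alternating :: "(pt3 \<Rightarrow> real) \<Rightarrow> pt3 \<Rightarrow> real" where
  "alternating p = (\<lambda>((a, b), t). sgn (1/2 - a) * sgn (1/2 - b) *
     min (min (p ((a, b), t)) (p ((1 - a, b), t))) (min (p ((a, 1 - b), t)) (p ((1 - a, 1 - b), t))))"

lemma borel_measurable_alternating [measurable]:
  assumes [measurable]: "p \<in> borel_measurable borel"
  shows "alternating p \<in> borel_measurable borel"
proof -
  have [measurable]: "p \<in> borel_measurable ((borel \<Otimes>\<^sub>M borel) \<Otimes>\<^sub>M borel)"
    using assms by (simp add: borel_prod)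
  have "alternating p \<in> borel_measurable ((borel \<Otimes>\<^sub>M borel) \<Otimes>\<^sub>M borel)"
    unfolding alternating_def sgn_real_def split_beta' by measurable
  then show ?thesis by (simp add: borel_prod)
qed

lemma abs_alternating_le:
  assumes "\<And>x. 0 \<le> p x"
  shows "\<bar>alternating p x\<bar> \<le> p x"
proof -
  obtain a b t where x: "x = ((a, b), t)" by (metis prod.collapse)
  have "\<bar>alternating p x\<bar> \<le> 1 * p x"
    unfolding x alternating_def prod.case abs_mult using assms
    by (intro mult_mono) (auto simp: abs_sgn_eq)
  then show ?thesis by simp
qed

lemma alternating_reflect:
  "alternating p ((1 - a, b), t) = - alternating p ((a, b), t)"
  "alternating p ((a, 1 - b), t) = - alternating p ((a, b), t)"
  by (auto simp: alternating_def sgn_real_def min.commute min.left_commute min.assoc)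

lemma integrable_alternating:
  assumes "integrable lborel p" "\<And>x. 0 \<le> p x"
  shows "integrable lborel (alternating p)"
  using assms abs_alternating_le[of p]
  by (intro Bochner_Integration.integrable_bound[OF assms(1)]) auto

text \<open>Reflecting the coordinate that runs over all of \<open>{0..1}\<close> preserves Lebesgue
  measure and the rectangle but flips the sign, so the integral equals its own negative.\<close>

lemma slice_alternating_eq_0:
  assumes "p \<in> borel_measurable borel"
  shows "slice (alternating p) ({0..x} \<times> {0..1}) t = 0"
    and "slice (alternating p) ({0..1} \<times> {0..x}) t = 0"
proof -
  have [measurable]: "alternating p \<in> borel_measurable borel"
    using assms by measurable
  have m: "(\<lambda>u. indicator ({a..b} \<times> {c..d}) u * alternating p (u, t)) \<in> borel_measurable borel" for a b c d
    by measurable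
  have "slice (alternating p) ({0..x} \<times> {0..1}) t =
     (\<integral>u. indicator ({0..x} \<times> {0..1}) u * alternating p (u, t) \<partial>distr lborel borel (\<lambda>(a, b). (a, 1 - b)))"
    by (simp add: slice_def distr_lborel_reflect)
  also have "\<dots> = (\<integral>u. - (indicator ({0..x} \<times> {0..1}) u * alternating p (u, t)) \<partial>lborel)"
  proof -
    have "indicator ({0..x} \<times> {0..1}) (case u of (a, b) \<Rightarrow> (a, 1 - b)) * alternating p (case u of (a, b) \<Rightarrow> (a, 1 - b), t)
        = - (indicator ({0..x} \<times> {0..1}) u * alternating p (u, t))" for u
      by (cases u) (auto simp: indicator_def alternating_reflect)
    moreover have "(\<lambda>(a::real, b::real). (a, 1 - b)) \<in> measurable lborel borel"
      using borel_measurable_reflect by simp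
    ultimately show ?thesis
      by (simp only: integral_distr[OF _ m])
  qed
  finally show "slice (alternating p) ({0..x} \<times> {0..1}) t = 0"
    by (simp add: slice_def)
  have "slice (alternating p) ({0..1} \<times> {0..x}) t =
     (\<integral>u. indicator ({0..1} \<times> {0..x}) u * alternating p (u, t) \<partial>distr lborel borel (\<lambda>(a, b). (1 - a, b)))"
    by (simp add: slice_def distr_lborel_reflect)
  also have "\<dots> = (\<integral>u. - (indicator ({0..1} \<times> {0..x}) u * alternating p (u, t)) \<partial>lborel)"
  proof -
    have "indicator ({0..1} \<times> {0..x}) (case u of (a, b) \<Rightarrow> (1 - a, b)) * alternating p (case u of (a, b) \<Rightarrow> (1 - a, b), t)
        = - (indicator ({0..1} \<times> {0..x}) u * alternating p (u, t))" for u
      by (cases u) (auto simp: indicator_def alternating_reflect)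
    moreover have "(\<lambda>(a::real, b::real). (1 - a, b)) \<in> measurable lborel borel"
      using borel_measurable_reflect by simp
    ultimately show ?thesis
      by (simp only: integral_distr[OF _ m])
  qed
  finally show "slice (alternating p) ({0..1} \<times> {0..x}) t = 0"
    by (simp add: slice_def)
qed

text \<open>Fubini for null sets, with the order of the coordinates exchanged. The exchange requires
  a measurable set, so the exceptional set is first covered by a Borel null set
  \<open>N\<close>.\<close>

lemma AE_section:
  fixes P :: "pt3 \<Rightarrow> bool"
  assumes P: "AE x in lborel. P x"
  shows "AE t in lborel. AE u in lborel. P (u, t)"
proof -
  obtain N where N: "N \<in> sets lborel" "emeasure lborel N = 0" "{x \<in> space lborel. \<not> P x} \<subseteq> N"
    using P by (auto elim!: AE_E)
  have "AE x in lborel \<Otimes>\<^sub>M lborel. x \<notin> N"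
    using N by (simp add: lborel_prod AE_not_in null_sets_def)
  from lborel_pair.AE_pair[OF this]
  have "AE u in lborel. AE t in lborel. (u, t) \<notin> N" .
  moreover have "{x \<in> space (lborel \<Otimes>\<^sub>M lborel). (fst x, snd x) \<notin> N} \<in> sets (lborel \<Otimes>\<^sub>M lborel)"
    using N(1) by (simp only: lborel_prod sets_lborel space_lborel prod.collapse space_borel) (simp flip: Compl_eq)
  ultimately have "AE t in lborel. AE u in lborel. (u, t) \<notin> N"
    by (subst (asm) lborel_pair.AE_commute) auto
  then show ?thesis
    by (rule AE_mp) (rule AE_I2, rule impI, erule AE_mp, use N(3) in auto)
qed

text \<open>On the open quarter square the sign is 1 and the four reflected points lie in the cube,
  so the minimum is positive almost everywhere there.\<close>

lemma slice_alternating_quarter_pos: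
  assumes p: "integrable lborel p" "\<And>x. 0 \<le> p x" and pos: "AE x in lborel. x \<in> I3 \<longrightarrow> 0 < p x"
  shows "AE t in lborel. t \<in> {0..1} \<longrightarrow> 0 < slice (alternating p) quarter t"
  using AE_section[OF pos] AE_integrable_section[OF integrable_alternating[OF p]]
proof eventually_elim
  case (elim t)
  show ?case
  proof
    assume t: "t \<in> {0..1}"
    let ?g = "\<lambda>u. indicator quarter u * alternating p (u, t)"
    have g: "integrable lborel ?g"
      using integrable_real_mult_indicator[OF _ elim(2), of quarter] by (simp add: mult.commute)
    have g0: "0 \<le> ?g u" for u
      using p(2) by (cases u) (auto simp: indicator_def alternating_def sgn_real_def)
    \<comment> \<open>A measure-preserving map pulls null sets back to null sets; this gives
      positivity of \<open>p\<close> at the reflected points too.\<close>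
    have refl: "AE u in lborel. (f u, t) \<in> I3 \<longrightarrow> 0 < p (f u, t)"
      if "f \<in> borel_measurable borel" "distr lborel borel f = lborel" for f :: "real \<times> real \<Rightarrow> real \<times> real"
    proof (rule AE_distrD[where P = "\<lambda>u. (u, t) \<in> I3 \<longrightarrow> 0 < p (u, t)" and M' = borel])
      show "AE u in distr lborel borel f. (u, t) \<in> I3 \<longrightarrow> 0 < p (u, t)"
        unfolding that(2) by (rule elim(1))
    qed (use that(1) in simp)
    have refl2: "distr lborel borel ((\<lambda>(a, b). (1 - a, b)) \<circ> (\<lambda>(a::real, b::real). (a, 1 - b))) = lborel"
      by (subst distr_distr[symmetric, of _ borel borel]) (auto simp: distr_lborel_reflect)
    have pos: "AE u in lborel. u \<in> {0<..<1/2} \<times> {0<..<1/2} \<longrightarrow> ?g u \<noteq> 0"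
      using elim(1) refl[OF borel_measurable_reflect(1) distr_lborel_reflect(1)]
        refl[OF borel_measurable_reflect(2) distr_lborel_reflect(2)]
        refl[OF measurable_comp[OF borel_measurable_reflect(2) borel_measurable_reflect(1)] refl2]
    proof eventually_elim
      case (elim u)
      obtain a b where u: "u = (a, b)" by (cases u)
      show ?case
      proof
        assume "u \<in> {0<..<1/2} \<times> {0<..<1/2}"
        then have ab: "0 < a" "a < 1/2" "0 < b" "b < 1/2" by (auto simp: u)
        then have I: "((a, b), t) \<in> I3" "((1 - a, b), t) \<in> I3" "((a, 1 - b), t) \<in> I3" "((1 - a, 1 - b), t) \<in> I3"
          using t by (auto simp: I3_def)
        have "0 < alternating p (u, t)"
          using elim I ab by (simp add: u alternating_def)
        then show "?g u \<noteq> 0" using ab by (simp add: u)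
      qed
    qed
    let ?S = "{0<..<1/2} \<times> {0<..<1/2} :: (real \<times> real) set"
    \<comment> \<open>A zero integral would make the nonnegative \<open>?g\<close> vanish almost
      everywhere, although it is nonzero almost everywhere on a square of measure 1/4.\<close>
    have "(\<integral>u. ?g u \<partial>lborel) \<noteq> 0"
    proof
      assume "(\<integral>u. ?g u \<partial>lborel) = 0"
      then have "AE u in lborel. ?g u = 0"
        using integral_nonneg_eq_0_iff_AE[OF g] g0 by simp
      with pos have "AE u in lborel. u \<notin> ?S"
        by eventually_elim auto
      moreover have S: "?S \<in> sets (lborel :: (real \<times> real) measure)"
        by (auto intro!: borel_open open_Times)
      ultimately have "emeasure lborel (?S) = 0"
        by (subst (asm) AE_iff_measurable[OF S]) auto
      moreover have "emeasure lborel (?S) = ennreal (1/2) * ennreal (1/2)"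
        unfolding lborel_prod[symmetric] by (subst lborel.emeasure_pair_measure_Times) auto
      ultimately show False by (simp add: ennreal_mult[symmetric])
    qed
    moreover have "0 \<le> (\<integral>u. ?g u \<partial>lborel)"
      using g0 by (intro Bochner_Integration.integral_nonneg)
    ultimately show "0 < slice (alternating p) quarter t"
      by (simp add: slice_def)
  qed
qed

section \<open>Sets of positive measure, copulas from densities, divergence bounds\<close>

text \<open>\<open>P\<close> is the countable union of the level sets of
  \<open>\<lfloor>f x / \<eta>\<rfloor>\<close>, so one of them has positive measure.\<close>

lemma positive_measure_small_oscillation:
  fixes f :: "'a \<Rightarrow> real"
  assumes f[measurable]: "f \<in> borel_measurable M" and P[measurable]: "P \<in> sets M"
    and pos: "emeasure M P \<noteq> 0" and \<eta>: "0 < \<eta>"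
  obtains P' where "P' \<in> sets M" "P' \<subseteq> P" "emeasure M P' \<noteq> 0"
    "\<And>s t. s \<in> P' \<Longrightarrow> t \<in> P' \<Longrightarrow> \<bar>f s - f t\<bar> < \<eta>"
proof -
  define Q where "Q i = {x \<in> space M. x \<in> P \<and> \<lfloor>f x / \<eta>\<rfloor> = i}" for i :: int
  have Q[measurable]: "Q i \<in> sets M" for i
    unfolding Q_def by measurable
  have "\<exists>i. emeasure M (Q i) \<noteq> 0"
  proof (rule ccontr)
    assume "\<not> ?thesis"
    then have "AE x in M. x \<notin> Q i" for i
      by (intro AE_not_in) (auto simp: null_sets_def)
    then have "AE x in M. \<forall>i. x \<notin> Q i"
      by (simp add: AE_all_countable)
    then have "AE x in M. x \<notin> P"
      using AE_space by eventually_elim (auto simp: Q_def)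
    then show False
      using pos P by (simp add: AE_iff_null_sets[symmetric] null_sets_def)
  qed
  then obtain i where i: "emeasure M (Q i) \<noteq> 0" by blast
  have "\<bar>f s - f t\<bar> < \<eta>" if "s \<in> Q i" "t \<in> Q i" for s t
  proof -
    have "\<bar>f s / \<eta> - f t / \<eta>\<bar> < 1"
      using that unfolding Q_def by (simp add: floor_eq_iff) linarith
    then show ?thesis
      using \<eta> by (simp add: diff_divide_distrib[symmetric])
  qed
  with i that[of "Q i"] Q show ?thesis
    by (auto simp: Q_def)
qed

text \<open>Turns a perturbed density back into a member of \<open>Cac_pos\<close>: only positivity
  and the three margins have to be checked.\<close>

lemma copula_of_density:
  assumes q: "integrable lborel q" "\<And>x. 0 \<le> q x" "\<And>x. x \<notin> I3 \<Longrightarrow> q x = 0"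
    and pos: "AE x in lborel. x \<in> I3 \<longrightarrow> 0 < q x"
    and m1: "\<And>x. x \<in> {0..1} \<Longrightarrow> (\<integral>z. indicator (({0..x} \<times> {0..1}) \<times> {0..1}) z * q z \<partial>lborel) = x"
    and m2: "\<And>x. x \<in> {0..1} \<Longrightarrow> (\<integral>z. indicator (({0..1} \<times> {0..x}) \<times> {0..1}) z * q z \<partial>lborel) = x"
    and m3: "\<And>x. x \<in> {0..1} \<Longrightarrow> (\<integral>z. indicator (({0..1} \<times> {0..1}) \<times> {0..x}) z * q z \<partial>lborel) = x"
  obtains C where "C \<in> Cac_pos" "cube_density C q"
proof -
  define C where "C = (\<lambda>((u1, u2), v). if ((u1, u2), v) \<in> I3
     then \<integral>z. indicator (({0..u1} \<times> {0..u2}) \<times> {0..v}) z * q z \<partial>lborel else 0)"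
  define \<mu> where "\<mu> = density lborel (\<lambda>x. ennreal (q x))"
  have C: "C ((u1, u2), v) = (\<integral>z. indicator (({0..u1} \<times> {0..u2}) \<times> {0..v}) z * q z \<partial>lborel)"
    if "u1 \<in> {0..1}" "u2 \<in> {0..1}" "v \<in> {0..1}" for u1 u2 v
    using that by (simp add: C_def I3_def)
  have box: "({0..u1} \<times> {0..u2}) \<times> {0..v} \<in> sets (borel :: pt3 measure)" for u1 u2 v
    by (simp add: borel_Times)
  have \<mu>: "emeasure \<mu> X = ennreal (\<integral>x. indicator X x * q x \<partial>lborel)" if "X \<in> sets borel" for X
    unfolding \<mu>_def using emeasure_density_lborel[OF q(1,2) that] .
  have "(\<lambda>x. indicator I3 x * q x) = q"
  proof
    show "indicator I3 x * q x = q x" for x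
      by (cases "x \<in> I3") (simp_all add: q(3))
  qed
  then have one: "(\<integral>x. q x \<partial>lborel) = 1"
    using m1[of 1] by (simp add: I3_def)
  have "copula3_measure \<mu> C"
    unfolding copula3_measure_def
  proof (intro conjI ballI)
    show "prob_space \<mu>"
      by (rule prob_spaceI) (use \<mu>[of UNIV] one in \<open>simp add: \<mu>_def\<close>)
    show "emeasure \<mu> I3 = 1"
      unfolding I3_def using m1[of 1] by (simp add: \<mu> box)
    show "C ((u1, u2), v) = measure \<mu> (({0..u1} \<times> {0..u2}) \<times> {0..v})"
      if "u1 \<in> {0..1}" "u2 \<in> {0..1}" "v \<in> {0..1}" for u1 u2 v
      using that q(2) by (simp add: C measure_def \<mu> box)
    show "sets \<mu> = sets borel" by (simp add: \<mu>_def)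
  qed (auto simp: \<mu> box m1 m2 m3)
  then have "is_copula3 C"
    by (auto simp: is_copula3_def C_def)
  moreover have "is_density3 C q"
    using q C by (auto simp: is_density3_def set_integrable_def set_lebesgue_integral_def \<open>(\<lambda>x. indicator I3 x * q x) = q\<close>
      dest: borel_measurable_integrable)
  ultimately have "C \<in> Cac_pos"
    using pos by (auto simp: Cac_pos_def)
  moreover have "cube_density C q"
    using q C by (simp add: cube_density_def)
  ultimately show ?thesis by (rule that)
qed

lemma Cac_pos_margins:
  assumes "C \<in> Cac_pos" "x \<in> {0..1}"
  shows "C ((x, 1), 1) = x" "C ((1, x), 1) = x" "C ((1, 1), x) = x"
  using assms by (auto simp: Cac_pos_def is_copula3_def copula3_measure_def measure_def)

text \<open>With \<open>q = p * (1 + y)\<close> and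
  \<open>\<bar>y\<bar> \<le> \<epsilon> \<le> 1/2\<close>, the logarithm is at most
  \<open>\<bar>y\<bar> + 2 * y^2 \<le> 2 * \<epsilon>\<close> in modulus and the factor
  \<open>1 + y\<close> at most 3/2.\<close>

lemma abs_mult_ln_div_le:
  fixes p q \<epsilon> :: real
  assumes "0 \<le> p" "\<bar>q - p\<bar> \<le> \<epsilon> * p" "\<epsilon> \<le> 1/2"
  shows "\<bar>q * ln (q / p)\<bar> \<le> 3 * \<epsilon> * p"
proof (cases "p = 0")
  case False
  define y where "y = q / p - 1"
  have q: "q = p * (1 + y)" using False by (simp add: y_def)
  have y: "\<bar>y\<bar> \<le> \<epsilon>"
    using assms(1,2) False by (simp add: q algebra_simps abs_mult)
  have "\<bar>ln (1 + y) - y\<bar> \<le> 2 * y\<^sup>2"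
    using y assms(3) by (intro abs_ln_one_plus_x_minus_x_bound) linarith
  also have "2 * y\<^sup>2 \<le> \<bar>y\<bar>"
  proof -
    have "\<bar>y\<bar> * \<bar>y\<bar> \<le> \<bar>y\<bar> * (1/2)"
      using y assms(3) by (intro mult_left_mono) auto
    then show ?thesis by (simp add: power2_eq_square)
  qed
  finally have "\<bar>ln (1 + y)\<bar> \<le> 2 * \<epsilon>" using y by linarith
  then have "\<bar>1 + y\<bar> * \<bar>ln (1 + y)\<bar> \<le> (3/2) * (2 * \<epsilon>)"
    using y assms(3) by (intro mult_mono) auto
  then have "p * (\<bar>1 + y\<bar> * \<bar>ln (1 + y)\<bar>) \<le> p * ((3/2) * (2 * \<epsilon>))"
    using assms(1) by (intro mult_left_mono) auto
  then show ?thesis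
    using False assms(1) by (simp add: q abs_mult mult_ac)
qed (use assms in auto)

lemma KL_perturbation_bound:
  assumes C: "C \<in> Cac_pos" "C' \<in> Cac_pos" and p: "cube_density C p" and q: "cube_density C' q"
    and le: "\<And>x. \<bar>q x - p x\<bar> \<le> \<epsilon> * p x" and \<epsilon>: "\<epsilon> \<le> 1/2"
  shows "\<exists>r. KL C' C = ereal r \<and> \<bar>r\<bar> \<le> 3 * \<epsilon>"
proof -
  have ip: "integrable lborel p" and iq: "integrable lborel q" and p0: "\<And>x. 0 \<le> p x"
    using p q unfolding cube_density_def by blast+
  have bound: "\<bar>q x * ln (q x / p x)\<bar> \<le> 3 * \<epsilon> * p x" for x
    using p0 le \<epsilon> by (rule abs_mult_ln_div_le)
  have [measurable]: "p \<in> borel_measurable borel" "q \<in> borel_measurable borel"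
    using ip iq by (auto dest: borel_measurable_integrable)
  have i3: "integrable lborel (\<lambda>x. 3 * \<epsilon> * p x)" using ip by simp
  have "3 * \<epsilon> * p x \<le> \<bar>3 * \<epsilon> * p x\<bar>" for x by simp
  then have int: "integrable lborel (\<lambda>x. q x * ln (q x / p x))"
    using order_trans[OF bound] by (intro Bochner_Integration.integrable_bound[OF i3]) (auto intro!: AE_I2)
  have one: "(\<integral>x. p x \<partial>lborel) = 1"
    using integral_cong_AE[OF _ _ cube_density_AE_eq_copula_density[OF C(1) p]]
      Cac_pos_copula_density(1,3)[OF C(1)] ip
    by (auto simp: cube_density_def)
  have "\<bar>\<integral>x. q x * ln (q x / p x) \<partial>lborel\<bar> \<le> (\<integral>x. \<bar>q x * ln (q x / p x)\<bar> \<partial>lborel)"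
    by (rule integral_abs_bound)
  also have "\<dots> \<le> (\<integral>x. 3 * \<epsilon> * p x \<partial>lborel)"
    using int i3 bound by (intro integral_mono) auto
  also have "\<dots> = 3 * \<epsilon>" using one by simp
  finally show ?thesis
    using int by (simp add: KL_eq[OF C(2,1) q p])
qed

lemma AE_obtain_in_positive_set:
  assumes "AE x in M. R x" "B \<in> sets M" "emeasure M B \<noteq> 0"
  obtains x where "x \<in> B" "R x"
proof -
  have "\<exists>x\<in>B. R x"
  proof (rule ccontr)
    assume "\<not> ?thesis"
    with assms(1) have "AE x in M. x \<notin> B" by (auto elim!: AE_mp)
    then show False
      using assms(2,3) by (simp add: AE_iff_null_sets[symmetric] null_sets_def)
  qed
  then show ?thesis using that by blast
qed

text \<open>Small oscillation of the identity yields a piece \<open>B\<close> of positive measure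
  inside an interval of length \<open>m / 2\<close>, where \<open>m\<close> is the measure of
  \<open>P\<close>; hence \<open>B\<close> cannot exhaust \<open>P\<close>.\<close>

lemma split_positive_measure_unit:
  assumes P: "P \<in> sets lborel" "P \<subseteq> {0..1::real}" "emeasure lborel P \<noteq> 0"
  obtains B where "B \<in> sets lborel" "B \<subseteq> P" "emeasure lborel B \<noteq> 0" "emeasure lborel (P - B) \<noteq> 0"
proof -
  have "emeasure lborel P \<le> emeasure lborel {0..1::real}"
    using P by (intro emeasure_mono) auto
  then have fin: "emeasure lborel P \<noteq> \<infinity>"
    by (auto simp: top_unique)
  define m where "m = measure lborel P"
  have em: "emeasure lborel P = ennreal m"
    using fin by (simp add: m_def emeasure_eq_ennreal_measure)
  then have m: "0 < m" using P(3) by (simp add: ennreal_eq_0_iff not_le)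
  obtain B where B: "B \<in> sets lborel" "B \<subseteq> P" "emeasure lborel B \<noteq> 0"
    and small: "\<And>s t. s \<in> B \<Longrightarrow> t \<in> B \<Longrightarrow> \<bar>s - t\<bar> < m / 4"
    by (rule positive_measure_small_oscillation[of "\<lambda>x. x" lborel P "m / 4"]) (use P m in auto)
  obtain s where s: "s \<in> B" using B(3) by fastforce
  have "B \<subseteq> {s - m / 4 .. s + m / 4}"
  proof
    fix t assume "t \<in> B"
    from small[OF s this] show "t \<in> {s - m / 4 .. s + m / 4}"
      unfolding atLeastAtMost_iff by linarith
  qed
  then have "emeasure lborel B \<le> emeasure lborel {s - m / 4 .. s + m / 4}"
    by (intro emeasure_mono) auto
  also have "\<dots> = ennreal (m / 2)"
    using m by simp
  also have "\<dots> < emeasure lborel P"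
    using m by (simp add: em ennreal_less_iff)
  finally have lt: "emeasure lborel B < emeasure lborel P" .
  then have "emeasure lborel (P - B) \<noteq> 0"
    using B P fin by (subst emeasure_Diff) (auto simp: diff_eq_0_iff_ennreal)
  with B show ?thesis by (intro that)
qed

section \<open>Violating the Lipschitz condition at small divergence\<close>

text \<open>The perturbation acts only at heights \<open>t\<close> in \<open>B\<close>. Between
  \<open>B\<close> and \<open>P - B\<close> the quarter slice then jumps, while the half slices,
  which the perturbation leaves alone, stay nearly equal.\<close>

lemma exists_KL_near_not_slice_lipschitz:
  assumes C: "C \<in> Cac_pos" and \<epsilon>: "0 < \<epsilon>" "\<epsilon> \<le> 1/2"
  shows "\<exists>C'\<in>Cac_pos. \<not> slice_lipschitz (copula_density C') \<and> (\<exists>r. KL C' C = ereal r \<and> \<bar>r\<bar> \<le> 3 * \<epsilon>)"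
proof -
  define p where "p = copula_density C"
  have cd: "cube_density C p" and pos: "AE x in lborel. x \<in> I3 \<longrightarrow> 0 < p x"
    using Cac_pos_copula_density[OF C] by (auto simp: p_def)
  have p: "integrable lborel p" "\<And>x. 0 \<le> p x" "\<And>x. x \<notin> I3 \<Longrightarrow> p x = 0"
    using cd unfolding cube_density_def by blast+
  have [measurable]: "p \<in> borel_measurable borel"
    using p(1) by (auto dest: borel_measurable_integrable)
  note alt = integrable_alternating[OF p(1,2)]
  define M where "M = slice (alternating p) quarter"
  have slice_meas: "slice f ({a..b} \<times> {c..d}) \<in> borel_measurable lborel" if "integrable lborel f" for f a b c d
    using that by (intro borel_measurable_integrable integrable_slice) auto
  have [measurable]: "M \<in> borel_measurable borel"
    using slice_meas[OF alt] by (simp add: M_def)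
  \<comment> \<open>\<open>M\<close> is positive almost everywhere on the unit interval, so by
    countable additivity it exceeds some \<open>1 / Suc n\<close> on a set of positive
    measure.\<close>
  have "\<exists>n. emeasure lborel {t \<in> {0..1}. 1 / Suc n < M t} \<noteq> 0"
  proof (rule ccontr)
    assume "\<not> ?thesis"
    then have "AE t in lborel. t \<notin> {t \<in> {0..1}. 1 / Suc n < M t}" for n
      by (intro AE_not_in) (auto simp: null_sets_def)
    then have "AE t in lborel. \<forall>n. t \<notin> {t \<in> {0..1}. 1 / Suc n < M t}"
      by (simp only: AE_all_countable simp_thms)
    moreover have "AE t in lborel. t \<in> {0..1} \<longrightarrow> 0 < M t"
      unfolding M_def using slice_alternating_quarter_pos[OF p(1,2) pos] .
    ultimately have "AE t in lborel. t \<notin> {0..1::real}"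
    proof eventually_elim
      case (elim t)
      show ?case
      proof
        assume t: "t \<in> {0..1}"
        with elim(2) obtain n where "1 / Suc n < M t"
          using nat_approx_posE by blast
        with t elim(1) show False by blast
      qed
    qed
    from AE_obtain_in_positive_set[OF this, of "{0..1}"] show False by auto
  qed
  then obtain n where n: "emeasure lborel {t \<in> {0..1}. 1 / Suc n < M t} \<noteq> 0" by blast
  define \<delta> where "\<delta> = 1 / real (Suc n)"
  have \<delta>: "0 < \<delta>" by (simp add: \<delta>_def)
  \<comment> \<open>The raise exceeds \<open>\<epsilon> * \<delta> = 4 * \<eta>\<close>. After an
    oscillation below \<eta> the quarter slices still differ by more than \<open>3 * \<eta>\<close>,
    whereas the two half slices allow less than \<open>2 * \<eta>\<close>.\<close>
  define \<eta> where "\<eta> = \<epsilon> * \<delta> / 4"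
  have \<eta>: "0 < \<eta>" using \<epsilon> \<delta> by (simp add: \<eta>_def)
  define P0 where "P0 = {t \<in> {0..1}. \<delta> < M t}"
  have P0: "P0 \<in> sets lborel" "emeasure lborel P0 \<noteq> 0"
    using n by (auto simp: P0_def \<delta>_def)
  \<comment> \<open>Three successive refinements make the quarter slice and both half slices nearly
    constant on one set of positive measure.\<close>
  obtain P1 where P1: "P1 \<in> sets lborel" "P1 \<subseteq> P0" "emeasure lborel P1 \<noteq> 0"
    and osc1: "\<And>s t. s \<in> P1 \<Longrightarrow> t \<in> P1 \<Longrightarrow> \<bar>slice p quarter s - slice p quarter t\<bar> < \<eta>"
    using positive_measure_small_oscillation[OF slice_meas[OF p(1)] P0 \<eta>] by blast
  obtain P2 where P2: "P2 \<in> sets lborel" "P2 \<subseteq> P1" "emeasure lborel P2 \<noteq> 0"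
    and osc2: "\<And>s t. s \<in> P2 \<Longrightarrow> t \<in> P2 \<Longrightarrow> \<bar>slice p left_half s - slice p left_half t\<bar> < \<eta>"
    using positive_measure_small_oscillation[OF slice_meas[OF p(1)] P1(1,3) \<eta>] by blast
  obtain P where P: "P \<in> sets lborel" "P \<subseteq> P2" "emeasure lborel P \<noteq> 0"
    and osc3: "\<And>s t. s \<in> P \<Longrightarrow> t \<in> P \<Longrightarrow> \<bar>slice p lower_half s - slice p lower_half t\<bar> < \<eta>"
    using positive_measure_small_oscillation[OF slice_meas[OF p(1)] P2(1,3) \<eta>] by blast
  have P_P0: "P \<subseteq> P0" using P(2) P2(2) P1(2) by blast
  then have P01: "P \<subseteq> {0..1}" unfolding P0_def by blast
  obtain B where B: "B \<in> sets lborel" "B \<subseteq> P" "emeasure lborel B \<noteq> 0" "emeasure lborel (P - B) \<noteq> 0"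
    using split_positive_measure_unit[OF P(1) P01 P(3)] by blast
  have [measurable]: "B \<in> sets borel" using B(1) by simp
  define k where "k x = indicator B (snd x) * alternating p x" for x :: pt3
  have k_le: "\<bar>k x\<bar> \<le> p x" for x
    using abs_alternating_le[of p x, OF p(2)] p(2)[of x] by (auto simp: k_def indicator_def)
  have "UNIV \<times> B \<in> sets (borel :: pt3 measure)"
    by (rule borel_Times) auto
  moreover have "k = (\<lambda>x. indicator (UNIV \<times> B) x * alternating p x)"
    by (auto simp: k_def indicator_def)
  ultimately have k_meas: "k \<in> borel_measurable borel"
    by (simp add: borel_measurable_alternating)
  have k: "integrable lborel k"
    using k_le p(2) k_meas by (intro Bochner_Integration.integrable_bound[OF p(1)]) auto
  have slice_k: "slice k E t = indicator B t * slice (alternating p) E t" for E t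
    by (simp add: slice_def k_def mult.left_commute[of "indicator E _"])
  have alt0: "slice (alternating p) ({0..x} \<times> {0..1}) t = 0" "slice (alternating p) ({0..1} \<times> {0..x}) t = 0" for x t
    using slice_alternating_eq_0 by auto
  define q where "q x = p x + \<epsilon> * k x" for x
  have q_diff: "\<bar>q x - p x\<bar> \<le> \<epsilon> * p x" for x
    using k_le[of x] \<epsilon>(1) by (simp add: q_def abs_mult)
  have half: "\<epsilon> * p x \<le> 1/2 * p x" for x
    using \<epsilon>(2) p(2)[of x] by (intro mult_right_mono) auto
  \<comment> \<open>Here \<epsilon> being at most 1/2 keeps \<open>q\<close> nonnegative, and
    positive wherever \<open>p\<close> is.\<close>
  have q_ge: "p x / 2 \<le> q x" for x
    using q_diff[of x] half[of x] by (simp add: abs_le_iff)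
  have q: "integrable lborel q"
    unfolding q_def using p(1) k by simp
  \<comment> \<open>Boxes over rectangles on which the alternating slices vanish keep their mass;
    these include the boxes that determine the three margins.\<close>
  have int_q: "(\<integral>x. indicator (E \<times> F) x * q x \<partial>lborel) = (\<integral>x. indicator (E \<times> F) x * p x \<partial>lborel)"
    if "E \<in> sets borel" "F \<in> sets borel" "\<And>t. slice (alternating p) E t = 0" for E F
  proof -
    have EF: "E \<times> F \<in> sets (lborel :: pt3 measure)"
      using that by (simp add: borel_Times)
    have ind: "integrable lborel (\<lambda>x. indicator (E \<times> F) x * f x)" if "integrable lborel f" for f :: "pt3 \<Rightarrow> real"
      using integrable_real_mult_indicator[OF EF that] by (simp add: mult.commute)
    have "(\<integral>x. indicator (E \<times> F) x * k x \<partial>lborel) = 0"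
      using integral_times_eq_slice[OF k that(1,2)] that(3) by (simp add: slice_k)
    moreover have "(\<lambda>x. indicator (E \<times> F) x * q x)
        = (\<lambda>x. indicator (E \<times> F) x * p x + \<epsilon> * (indicator (E \<times> F) x * k x))"
      by (simp add: q_def algebra_simps)
    ultimately show ?thesis
      using ind[OF p(1)] ind[OF k] by simp
  qed
  have box: "(\<integral>z. indicator (({0..u1} \<times> {0..u2}) \<times> {0..v}) z * p z \<partial>lborel) = C ((u1, u2), v)"
    if "u1 \<in> {0..1}" "u2 \<in> {0..1}" "v \<in> {0..1}" for u1 u2 v
    using cd that by (simp add: cube_density_def)
  obtain C' where C': "C' \<in> Cac_pos" "cube_density C' q"
  proof (rule copula_of_density[of q])
    show "0 \<le> q x" for x
      using q_ge[of x] p(2)[of x] by simp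
    show "q x = 0" if "x \<notin> I3" for x
      using q_diff[of x] p(3)[OF that] by simp
    show "AE x in lborel. x \<in> I3 \<longrightarrow> 0 < q x"
      using pos
    proof eventually_elim
      case (elim x)
      then show ?case using q_ge[of x] by auto
    qed
    show "(\<integral>z. indicator (({0..x} \<times> {0..1}) \<times> {0..1}) z * q z \<partial>lborel) = x"
      "(\<integral>z. indicator (({0..1} \<times> {0..x}) \<times> {0..1}) z * q z \<partial>lborel) = x"
      "(\<integral>z. indicator (({0..1} \<times> {0..1}) \<times> {0..x}) z * q z \<partial>lborel) = x"
      if "x \<in> {0..1}" for x
      using that Cac_pos_margins[OF C that] by (simp_all add: int_q alt0 box)
  qed (use q in auto)
  have "\<not> slice_lipschitz q"
  proof
    assume lip: "slice_lipschitz q"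
    define good where "good t \<longleftrightarrow> slice q quarter t = slice p quarter t + \<epsilon> * slice k quarter t \<and>
      slice q left_half t = slice p left_half t + \<epsilon> * slice k left_half t \<and>
      slice q lower_half t = slice p lower_half t + \<epsilon> * slice k lower_half t" for t
    have good: "AE t in lborel. good t"
      unfolding good_def q_def
      using AE_slice_add_scaled[OF p(1) k, of quarter \<epsilon>] AE_slice_add_scaled[OF p(1) k, of left_half \<epsilon>]
        AE_slice_add_scaled[OF p(1) k, of lower_half \<epsilon>]
      by (simp only: AE_conj_iff borel_Times_intervals simp_thms)
    \<comment> \<open>Since \<open>B\<close> and \<open>P - B\<close> both have positive measure,
      the almost-everywhere statements can be evaluated at some \<open>s\<close> in the first and
      then some \<open>t\<close> in the second.\<close>
    obtain s where s: "s \<in> B" "good s" and st: "AE t in lborel. s \<in> {0..1} \<longrightarrow> t \<in> {0..1} \<longrightarrow>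
       \<bar>slice q quarter s - slice q quarter t\<bar> \<le>
       \<bar>slice q left_half s - slice q left_half t\<bar> + \<bar>slice q lower_half s - slice q lower_half t\<bar>"
      using AE_obtain_in_positive_set[OF AE_conjI[OF good lip[unfolded slice_lipschitz_def]] B(1,3)] by blast
    obtain t where t: "t \<in> P - B" "good t" and le: "s \<in> {0..1} \<longrightarrow> t \<in> {0..1} \<longrightarrow>
       \<bar>slice q quarter s - slice q quarter t\<bar> \<le>
       \<bar>slice q left_half s - slice q left_half t\<bar> + \<bar>slice q lower_half s - slice q lower_half t\<bar>"
      using AE_obtain_in_positive_set[OF AE_conjI[OF good st] _ B(4)] P(1) B(1) by blast
    have in_P: "s \<in> P" "t \<in> P" using s t B(2) by auto
    then have in_P12: "s \<in> P1" "t \<in> P1" "s \<in> P2" "t \<in> P2" using P(2) P2(2) by auto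
    have "slice q quarter s = slice p quarter s + \<epsilon> * M s" "slice q quarter t = slice p quarter t"
      "slice q left_half s = slice p left_half s" "slice q left_half t = slice p left_half t"
      "slice q lower_half s = slice p lower_half s" "slice q lower_half t = slice p lower_half t"
      using s t by (auto simp: good_def slice_k M_def alt0)
    moreover have "\<bar>slice p quarter s - slice p quarter t\<bar> < \<eta>"
      "\<bar>slice p left_half s - slice p left_half t\<bar> < \<eta>"
      "\<bar>slice p lower_half s - slice p lower_half t\<bar> < \<eta>"
      using osc1[OF in_P12(1,2)] osc2[OF in_P12(3,4)] osc3[OF in_P] .
    moreover have "4 * \<eta> < \<epsilon> * M s"
    proof -
      have "\<delta> < M s" using in_P P_P0 unfolding P0_def by blast
      then show ?thesis using \<epsilon>(1) by (simp add: \<eta>_def)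
    qed
    moreover have "s \<in> {0..1}" "t \<in> {0..1}" using in_P P01 by blast+
    ultimately show False
      using le by simp
  qed
  then have "\<not> slice_lipschitz (copula_density C')"
    using slice_lipschitz_AE_cong[OF _ q cube_density_AE_eq_copula_density[OF C']]
      Cac_pos_copula_density(1)[OF C'(1)] by (auto simp: cube_density_def)
  moreover have "\<exists>r. KL C' C = ereal r \<and> \<bar>r\<bar> \<le> 3 * \<epsilon>"
    using KL_perturbation_bound[OF C C'(1) cd C'(2) q_diff \<epsilon>(2)] .
  ultimately show ?thesis using C'(1) by blast
qed

subsection \<open>The Kullback--Leibler topology\<close>

text \<open>The sequential condition is stable under unions and binary intersections, so it really
  defines a topology, and \<open>topology\<close> can be unfolded.\<close>

lemma openin_KL_top:
  "openin KL_top U \<longleftrightarrow> U \<subseteq> Cac_pos \<and>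
     (\<forall>C\<in>U. \<forall>s. (\<forall>n. s n \<in> Cac_pos) \<and> (\<lambda>n. KL (s n) C) \<longlonglongrightarrow> 0
          \<longrightarrow> eventually (\<lambda>n. s n \<in> U) sequentially)"
proof -
  let ?P = "\<lambda>U. U \<subseteq> Cac_pos \<and> (\<forall>C\<in>U. \<forall>s. (\<forall>n. s n \<in> Cac_pos) \<and> (\<lambda>n. KL (s n) C) \<longlonglongrightarrow> 0
          \<longrightarrow> eventually (\<lambda>n. s n \<in> U) sequentially)"
  have "istopology ?P"
    unfolding istopology_def
  proof (intro conjI allI impI)
    fix U V assume UV: "?P U" "?P V"
    then show "U \<inter> V \<subseteq> Cac_pos" by blast
    show "\<forall>C\<in>U \<inter> V. \<forall>s. (\<forall>n. s n \<in> Cac_pos) \<and> (\<lambda>n. KL (s n) C) \<longlonglongrightarrow> 0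
          \<longrightarrow> eventually (\<lambda>n. s n \<in> U \<inter> V) sequentially"
      using UV by (auto simp: eventually_conj_iff)
  next
    fix \<K> assume K: "\<forall>U\<in>\<K>. ?P U"
    then show "\<Union>\<K> \<subseteq> Cac_pos" by blast
    show "\<forall>C\<in>\<Union>\<K>. \<forall>s. (\<forall>n. s n \<in> Cac_pos) \<and> (\<lambda>n. KL (s n) C) \<longlonglongrightarrow> 0
          \<longrightarrow> eventually (\<lambda>n. s n \<in> \<Union>\<K>) sequentially"
    proof (intro ballI allI impI)
      fix C s assume "C \<in> \<Union>\<K>" and s: "(\<forall>n. s n \<in> Cac_pos) \<and> (\<lambda>n. KL (s n) C) \<longlonglongrightarrow> 0"
      then obtain U where U: "U \<in> \<K>" "C \<in> U" by blast
      then have "eventually (\<lambda>n. s n \<in> U) sequentially"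
        using K s by blast
      then show "eventually (\<lambda>n. s n \<in> \<Union>\<K>) sequentially"
        by eventually_elim (use U in blast)
    qed
  qed
  then show ?thesis
    by (simp only: KL_top_def topology_inverse')
qed

lemma topspace_KL_top: "topspace KL_top = Cac_pos"
proof
  show "topspace KL_top \<subseteq> Cac_pos"
    unfolding topspace_def by (auto simp: openin_KL_top)
  show "Cac_pos \<subseteq> topspace KL_top"
    by (rule openin_subset) (simp add: openin_KL_top)
qed

text \<open>If a sequence converging in divergence to \<open>C\<close> did not eventually stay in
  the complement, a subsequence would satisfy the Lipschitz condition. Divergence controls L1
  distance, so the L1 limit lemma would give the condition for \<open>C\<close>.\<close>

lemma closedin_KL_top_slice_lipschitz:
  "closedin KL_top {C \<in> Cac_pos. slice_lipschitz (copula_density C)}"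
  unfolding closedin_def topspace_KL_top
proof (intro conjI)
  show "openin KL_top (Cac_pos - {C \<in> Cac_pos. slice_lipschitz (copula_density C)})"
    unfolding openin_KL_top
  proof (intro conjI ballI allI impI)
    fix C s
    assume C: "C \<in> Cac_pos - {C \<in> Cac_pos. slice_lipschitz (copula_density C)}"
      and s: "(\<forall>n. s n \<in> Cac_pos) \<and> (\<lambda>n. KL (s n) C) \<longlonglongrightarrow> 0"
    show "\<forall>\<^sub>F n in sequentially. s n \<in> Cac_pos - {C \<in> Cac_pos. slice_lipschitz (copula_density C)}"
    proof (rule ccontr)
      assume "\<not> ?thesis"
      then have "\<exists>\<^sub>F n in sequentially. slice_lipschitz (copula_density (s n))"
        using s by (simp add: not_eventually)
      then have "infinite {n. slice_lipschitz (copula_density (s n))}"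
        by (simp add: cofinite_eq_sequentially[symmetric] frequently_cofinite)
      then obtain r :: "nat \<Rightarrow> nat" where r: "strict_mono r" "\<And>n. slice_lipschitz (copula_density (s (r n)))"
        using infinite_enumerate by blast
      have lim: "(\<lambda>n. \<integral>x. \<bar>copula_density (s n) x - copula_density C x\<bar> \<partial>lborel) \<longlonglongrightarrow> 0"
        by (rule KL_tendsto_0_imp_L1) (use s C in blast)+
      have int: "integrable lborel (copula_density D)" if "D \<in> Cac_pos" for D
        using Cac_pos_copula_density(1)[OF that] unfolding cube_density_def by blast
      have "slice_lipschitz (copula_density C)"
      proof (rule slice_lipschitz_L1_limit)
        show "(\<lambda>n. \<integral>x. \<bar>copula_density (s (r n)) x - copula_density C x\<bar> \<partial>lborel) \<longlonglongrightarrow> 0"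
          using LIMSEQ_subseq_LIMSEQ[OF lim r(1)] by (simp add: o_def)
      qed (use int s C r(2) in blast)+
      then show False using C by blast
    qed
  qed auto
qed auto

theorem theorem3p11:
  shows "KL_top interior_of (KL_top closure_of {C \<in> Cac_pos. simplified C}) = {}"
proof (rule ccontr)
  let ?S = "{C \<in> Cac_pos. simplified C}" and ?T = "{C \<in> Cac_pos. slice_lipschitz (copula_density C)}"
  assume "\<not> ?thesis"
  then obtain U C where U: "openin KL_top U" "C \<in> U" "U \<subseteq> KL_top closure_of ?S"
    by (auto simp: interior_of_def)
  have "?S \<subseteq> ?T"
    using simplified_imp_slice_lipschitz Cac_pos_copula_density(1) by blast
  then have "KL_top closure_of ?S \<subseteq> ?T"
    by (rule closure_of_minimal[OF _ closedin_KL_top_slice_lipschitz])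
  with U have UT: "U \<subseteq> ?T" and C: "C \<in> Cac_pos"
    by (auto simp: openin_KL_top)
  \<comment> \<open>The choice \<open>\<epsilon> = 1 / (n + 2)\<close> is at most 1/2 from
    \<open>n = 0\<close> on and tends to 0.\<close>
  have "\<forall>n. \<exists>C'. C' \<in> Cac_pos \<and> \<not> slice_lipschitz (copula_density C') \<and>
      (\<exists>r. KL C' C = ereal r \<and> \<bar>r\<bar> \<le> 3 * (1 / real (n + 2)))"
    using exists_KL_near_not_slice_lipschitz[OF C, of "1 / real (_ + 2)"] by (auto simp: Bex_def)
  then obtain s r where s: "\<And>n. s n \<in> Cac_pos" "\<And>n. \<not> slice_lipschitz (copula_density (s n))"
    and r: "\<And>n. KL (s n) C = ereal (r n)" "\<And>n. \<bar>r n\<bar> \<le> 3 * (1 / real (n + 2))"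
    by metis
  have "(\<lambda>n. 1 / real (n + 2)) \<longlonglongrightarrow> 0"
    using LIMSEQ_ignore_initial_segment[OF lim_1_over_n, of 2] by simp
  from tendsto_mult_right_zero[OF this, of 3] have "r \<longlonglongrightarrow> 0"
    by (rule Lim_null_comparison[rotated]) (use r(2) in simp)
  then have "(\<lambda>n. KL (s n) C) \<longlonglongrightarrow> 0"
    by (simp add: r(1) zero_ereal_def)
  \<comment> \<open>The open set \<open>U\<close> must eventually contain the sequence, but no
    \<open>s n\<close> satisfies the condition that holds on all of \<open>U\<close>.\<close>
  then have "\<forall>\<^sub>F n in sequentially. s n \<in> U"
    using U s by (simp add: openin_KL_top)
  then obtain n where "s n \<in> U"
    using eventually_happens by fastforce
  then show False using UT s(2) by blast
qed

end
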